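(* Let $G$ be an $n$-vertex graph without isolated vertices. Then the equality $\gamma(G)=\beta(G)$ can be verified in $O(n^2)$ time; that is, there is a deterministic algorithm that, given such a graph, decides in $O(n^2)$ time whether $\gamma(G)=\beta(G)$.
   Context: Graphs are finite, simple and undirected. $\gamma(G)$ is the domination number of $G$: the minimum cardinality of a set $D\subseteq V_G$ such that every vertex in $V_G-D$ has a neighbor in $D$. $\beta(G)$ is the covering number of $G$: the minimum cardinality of a set $C\subseteq V_G$ such that every edge of $G$ has at least one end-vertex in $C$. Running time is measured in the standard unit-cost RAM model, with the graph given by adjacency lists (or an adjacency matrix). *)

theory Defs
  imports "HOL-Library.Landau_Symbols"
begin

definition simple_graph :: "'a set \<Rightarrow> 'a set set \<Rightarrow> bool" where
  "simple_graph V E \<longleftrightarrow> finite V \<and> (\<forall>e\<in>E. e \<subseteq> V \<and> card e = 2)"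

definition isolated_vertex :: "'a set \<Rightarrow> 'a set set \<Rightarrow> 'a \<Rightarrow> bool" where
  "isolated_vertex V E v \<longleftrightarrow> v \<in> V \<and> (\<forall>e\<in>E. v \<notin> e)"

definition dominating_set :: "'a set \<Rightarrow> 'a set set \<Rightarrow> 'a set \<Rightarrow> bool" where
  "dominating_set V E D \<longleftrightarrow> D \<subseteq> V \<and> (\<forall>v\<in>V - D. \<exists>u\<in>D. {u, v} \<in> E)"

definition covering_set :: "'a set \<Rightarrow> 'a set set \<Rightarrow> 'a set \<Rightarrow> bool" where
  "covering_set V E C \<longleftrightarrow> C \<subseteq> V \<and> (\<forall>e\<in>E. e \<inter> C \<noteq> {})"

definition domination_number :: "'a set \<Rightarrow> 'a set set \<Rightarrow> nat" where
  "domination_number V E = (LEAST k. \<exists>D. dominating_set V E D \<and> card D = k)"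

definition covering_number :: "'a set \<Rightarrow> 'a set set \<Rightarrow> nat" where
  "covering_number V E = (LEAST k. \<exists>C. covering_set V E C \<and> card C = k)"

text \<open>
  A program is a fixed finite list of instructions over registers and an unbounded memory, all
  holding natural numbers.  Only addition and truncated subtraction are primitive; in particular
  there is no unit-cost multiplication.  Jump targets are absolute positions in the program.
  Registers are separate from the memory, so that the input does not collide with scratch
  registers; a program can access only the finitely many registers it mentions, and memory is the
  only indirectly addressable storage.
\<close>

type_synonym reg = nat

datatype instr =
    Const reg nat
  | Move reg reg
  | Add reg reg reg
  | Sub reg reg reg
  | Load reg reg
  | Store reg reg
  | Jump nat
  | JumpZero reg nat

type_synonym program = "instr list"

datatype config = Config (pc: nat) (regs: "reg \<Rightarrow> nat") (mem: "nat \<Rightarrow> nat")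

fun exec_instr :: "instr \<Rightarrow> config \<Rightarrow> config" where
  "exec_instr (Const i k) (Config p R M) = Config (Suc p) (R(i := k)) M"
| "exec_instr (Move i j) (Config p R M) = Config (Suc p) (R(i := R j)) M"
| "exec_instr (Add i j k) (Config p R M) = Config (Suc p) (R(i := R j + R k)) M"
| "exec_instr (Sub i j k) (Config p R M) = Config (Suc p) (R(i := R j - R k)) M"
| "exec_instr (Load i j) (Config p R M) = Config (Suc p) (R(i := M (R j))) M"
| "exec_instr (Store i j) (Config p R M) = Config (Suc p) R (M(R i := R j))"
| "exec_instr (Jump l) (Config p R M) = Config l R M"
| "exec_instr (JumpZero i l) (Config p R M) = Config (if R i = 0 then l else Suc p) R M"

text \<open>
  The machine halts when the program counter leaves the program; a halted configuration is a
  fixed point of the step function, so its output does not depend on how long one waits.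
\<close>

definition halted :: "program \<Rightarrow> config \<Rightarrow> bool" where
  "halted P c \<longleftrightarrow> length P \<le> pc c"

definition step :: "program \<Rightarrow> config \<Rightarrow> config" where
  "step P c = (if halted P c then c else exec_instr (P ! pc c) c)"

definition outputs_within :: "program \<Rightarrow> config \<Rightarrow> nat \<Rightarrow> nat \<Rightarrow> bool" where
  "outputs_within P c t out \<longleftrightarrow>
     (\<exists>k\<le>t. halted P ((step P ^^ k) c) \<and> regs ((step P ^^ k) c) 0 = out)"

text \<open>
  Initially register 0 holds the number of vertices, the memory holds the encoded graph from
  address 0 on, and everything else is 0.
\<close>

definition start :: "nat \<Rightarrow> nat list \<Rightarrow> config" where
  "start n xs = Config 0 ((\<lambda>_. 0)(0 := n)) (\<lambda>a. if a < length xs then xs ! a else 0)"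

text \<open>Vertices are numbered \<open>0, \<dots>, n - 1\<close>; the neighbours in each list may come in any order.\<close>

definition adjacency_lists :: "nat \<Rightarrow> nat set set \<Rightarrow> nat list list \<Rightarrow> bool" where
  "adjacency_lists n E ls \<longleftrightarrow>
     length ls = n \<and> (\<forall>u<n. distinct (ls ! u) \<and> set (ls ! u) = {v. {u, v} \<in> E})"

text \<open>
  Cell \<open>u < n\<close> contains the address at which the list of \<open>u\<close> starts and cell \<open>Suc u\<close> the address
  just past its end, where \<open>n = length ls\<close>; the lists themselves start at address \<open>Suc n\<close>.
\<close>

definition encode_lists :: "nat list list \<Rightarrow> nat list" where
  "encode_lists ls =
     map (\<lambda>u. Suc (length ls) + length (concat (take u ls))) [0..<Suc (length ls)] @ concat ls"

definition encode_matrix :: "nat \<Rightarrow> nat set set \<Rightarrow> nat list" where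
  "encode_matrix n E =
     concat (map (\<lambda>u. map (\<lambda>v. if {u, v} \<in> E then 1 else 0) [0..<n]) [0..<n])"

end

theory Submission
  imports Defs
begin

text \<open>
  Let \<open>C\<close> be a minimum covering with \<open>\<gamma>(G) = |C|\<close>. Exchanging leaves for their neighbours, we may assume that
  \<open>C\<close> contains every support (one end of each \<open>K\<^sub>2\<close>). Since no smaller set dominates, a vertex of \<open>C\<close> that is
  neither a leaf nor a support has no neighbour in \<open>C\<close>, and any two such vertices with a common neighbour have
  two common neighbours of degree 2. Conversely, any covering with these properties is a minimum dominating
  set, by a discharging argument. Call the vertices that are neither leaves nor supports the core; then
  \<open>\<gamma>(G) = \<beta>(G)\<close> iff the core has a proper 2-colouring (in \<open>C\<close> or not) in which neighbours of supports are
  outside \<open>C\<close> and every vertex with two core neighbours lacking two common neighbours of degree 2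
  is inside \<open>C\<close>.

  The last condition on a vertex of core degree \<open>d\<close> is tested by comparing the number of pairs of its
  core neighbours that do have two such common neighbours with \<open>d choose 2\<close>. The colouring
  is found by \<open>n\<close> rounds, each of which finishes one vertex, preferring coloured ones. All loops run from \<open>0\<close> to
  \<open>n - 1\<close> and are nested at most twice, which bounds the running time.
\<close>

section \<open>Equality as a constrained 2-colouring\<close>

text \<open>Outside the core every dominating set already pays one vertex per kept support, namely
  the support or a leaf at it, so only the core can make a difference. There minimality forbids two
  exchanges: deleting a vertex of \<open>C\<close> that is dominated anyway, and replacing two
  vertices of \<open>C\<close> by one common neighbour. Two common neighbours of degree 2 are
  exactly what blocks the second exchange, since one of them would be left undominated. The
  colouring needs no backtracking: a connected graph has at most two proper 2-colourings, which
  differ by a swap, and a vertex is coloured freely only when no unfinished vertex carries a colour,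
  so the swap is still available. The obstacle to quadratic time is the condition on common
  neighbours, as trying all pairs of neighbours at every vertex would be cubic. Since the machine
  cannot multiply, matrix rows, binomial coefficients and array strides all have to come from
  additions.\<close>

definition nbh :: "'a set set \<Rightarrow> 'a \<Rightarrow> 'a set" where
  "nbh E v = {u. {v, u} \<in> E}"

definition leaf :: "'a set set \<Rightarrow> 'a \<Rightarrow> bool" where
  "leaf E v \<longleftrightarrow> card (nbh E v) = 1"

definition support :: "'a set set \<Rightarrow> 'a \<Rightarrow> bool" where
  "support E v \<longleftrightarrow> (\<exists>u\<in>nbh E v. leaf E u)"

definition core :: "'a set \<Rightarrow> 'a set set \<Rightarrow> 'a set" where
  "core V E = {v\<in>V. \<not> leaf E v \<and> \<not> support E v}"

definition twins :: "'a set set \<Rightarrow> 'a \<Rightarrow> 'a \<Rightarrow> 'a set" where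
  "twins E x y = {w. nbh E w = {x, y}}"

text \<open>A vertex outside a covering has all its neighbours inside; two of them with fewer than
  two twins could be exchanged for one common neighbour. Without \<open>x \<noteq> y\<close> every
  vertex with a core neighbour would qualify: a core vertex has no leaf neighbour, so
  \<open>twins E x x\<close> is empty.\<close>

definition crowded :: "'a set \<Rightarrow> 'a set set \<Rightarrow> 'a \<Rightarrow> bool" where
  "crowded V E u \<longleftrightarrow>
     (\<exists>x\<in>nbh E u \<inter> core V E. \<exists>y\<in>nbh E u \<inter> core V E. x \<noteq> y \<and> card (twins E x y) < 2)"

definition admissible :: "'a set \<Rightarrow> 'a set set \<Rightarrow> ('a \<Rightarrow> bool) \<Rightarrow> bool" where
  "admissible V E f \<longleftrightarrow>
     (\<forall>v\<in>core V E. ((\<exists>s\<in>nbh E v. support E s) \<longrightarrow> \<not> f v) \<and> (crowded V E v \<longrightarrow> f v) \<and>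
        (\<forall>u\<in>nbh E v \<inter> core V E. f u \<noteq> f v))"

text \<open>Of a component \<open>K\<^sub>2\<close>, both ends of which are supports, only the smaller end is kept.\<close>

definition reduced_supports :: "'a::linorder set \<Rightarrow> 'a set set \<Rightarrow> 'a set" where
  "reduced_supports V E = {s\<in>V. support E s \<and> \<not> (leaf E s \<and> (\<exists>t\<in>nbh E s. leaf E t \<and> t < s))}"

section \<open>Neighbourhoods, dominating sets and coverings\<close>

locale graph_without_isolated =
  fixes V :: "'a::linorder set" and E :: "'a set set"
  assumes simple: "simple_graph V E"
    and no_isolated: "\<not> isolated_vertex V E v"
begin

lemma finite_V: "finite V"
  using simple by (simp add: simple_graph_def)

lemma nbh_sym: "u \<in> nbh E v \<longleftrightarrow> v \<in> nbh E u"
  by (simp add: nbh_def insert_commute)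

lemma nbh_in_V: "u \<in> nbh E v \<Longrightarrow> u \<in> V" "u \<in> nbh E v \<Longrightarrow> v \<in> V"
  using simple by (auto simp: nbh_def simple_graph_def)

lemma nbh_irrefl: "v \<notin> nbh E v"
  using simple by (force simp: nbh_def simple_graph_def)

lemma finite_nbh: "finite (nbh E v)"
  using finite_V nbh_in_V by (meson finite_subset subsetI)

lemma edge_cases:
  assumes "e \<in> E"
  obtains u v where "e = {u, v}" "u \<noteq> v" "u \<in> nbh E v" "v \<in> nbh E u"
proof -
  have "card e = 2" using simple assms by (simp add: simple_graph_def)
  then obtain u v where "e = {u, v}" "u \<noteq> v" by (auto simp: card_2_iff)
  then show ?thesis using that assms by (auto simp: nbh_def insert_commute)
qed

lemma nbh_nonempty:
  assumes "v \<in> V" shows "nbh E v \<noteq> {}"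
proof -
  from assms no_isolated obtain e where "e \<in> E" "v \<in> e"
    unfolding isolated_vertex_def by blast
  then show ?thesis by (elim edge_cases) auto
qed

lemma leaf_nbh: "leaf E v \<Longrightarrow> u \<in> nbh E v \<Longrightarrow> nbh E v = {u}"
  by (auto simp: leaf_def card_1_singleton_iff)

lemma leafI: "nbh E v = {u} \<Longrightarrow> leaf E v"
  by (simp add: leaf_def)

lemma dominating_iff:
  "dominating_set V E D \<longleftrightarrow> D \<subseteq> V \<and> (\<forall>v\<in>V - D. nbh E v \<inter> D \<noteq> {})"
  unfolding dominating_set_def nbh_def by (auto simp: insert_commute)

lemma covering_iff:
  "covering_set V E C \<longleftrightarrow> C \<subseteq> V \<and> (\<forall>v. v \<notin> C \<longrightarrow> nbh E v \<subseteq> C)"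
proof -
  have "(\<forall>e\<in>E. e \<inter> C \<noteq> {}) \<longleftrightarrow> (\<forall>v. v \<notin> C \<longrightarrow> nbh E v \<subseteq> C)"
  proof
    show "\<forall>e\<in>E. e \<inter> C \<noteq> {} \<Longrightarrow> \<forall>v. v \<notin> C \<longrightarrow> nbh E v \<subseteq> C"
      by (fastforce simp: nbh_def)
    show "\<forall>v. v \<notin> C \<longrightarrow> nbh E v \<subseteq> C \<Longrightarrow> \<forall>e\<in>E. e \<inter> C \<noteq> {}"
      by (blast elim: edge_cases)
  qed
  then show ?thesis by (simp add: covering_set_def)
qed

lemma covering_dominating: "covering_set V E C \<Longrightarrow> dominating_set V E C"
  using nbh_nonempty by (fastforce simp: covering_iff dominating_iff)

lemma domination_number_le: "dominating_set V E D \<Longrightarrow> domination_number V E \<le> card D"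
  unfolding domination_number_def by (rule Least_le) blast

lemma covering_number_le: "covering_set V E C \<Longrightarrow> covering_number V E \<le> card C"
  unfolding covering_number_def by (rule Least_le) blast

lemma covering_number_attained:
  obtains C where "covering_set V E C" "card C = covering_number V E"
proof -
  have "covering_set V E V"
    using nbh_in_V by (auto simp: covering_iff)
  then have "\<exists>k C. covering_set V E C \<and> card C = k" by blast
  from LeastI_ex[OF this] show ?thesis
    using that unfolding covering_number_def by blast
qed

lemma domination_number_attained:
  obtains D where "dominating_set V E D" "card D = domination_number V E"
proof -
  have "dominating_set V E V"
    by (auto simp: dominating_iff)
  then have "\<exists>k D. dominating_set V E D \<and> card D = k" by blast
  from LeastI_ex[OF this] show ?thesis
    using that unfolding domination_number_def by blast
qed

lemma domination_le_covering: "domination_number V E \<le> covering_number V E"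
  by (metis covering_number_attained covering_dominating domination_number_le)

section \<open>Supports and the bound outside the core\<close>

lemma core_nbhD:
  assumes "v \<in> core V E" "u \<in> nbh E v"
  shows "\<not> leaf E u" "u \<in> core V E \<or> support E u"
proof -
  show *: "\<not> leaf E u" using assms by (auto simp: core_def support_def)
  show "u \<in> core V E \<or> support E u" using * assms nbh_in_V by (auto simp: core_def)
qed

lemma support_in_reduced: "support E s \<Longrightarrow> \<not> leaf E s \<Longrightarrow> s \<in> reduced_supports V E"
  using nbh_in_V by (auto simp: reduced_supports_def support_def)

lemma reduced_supports_not_core: "s \<in> reduced_supports V E \<Longrightarrow> s \<notin> core V E"
  by (auto simp: reduced_supports_def core_def)

text \<open>Send a kept support to itself if it lies in \<open>D\<close>, and otherwise to one of
  its leaves, which must lie in \<open>D\<close> because its only neighbour does not. Neither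
  supports nor leaves are in the core, and a leaf determines its neighbour.\<close>

lemma card_reduced_supports_le:
  assumes D: "dominating_set V E D"
  shows "card (reduced_supports V E) \<le> card (D - core V E)"
proof (rule card_inj_on_le)
  define g where "g s = (if s \<in> D then s else SOME l. l \<in> nbh E s \<and> leaf E l)" for s
  have g: "g s \<in> nbh E s \<and> leaf E (g s)" if "s \<in> reduced_supports V E" "s \<notin> D" for s
  proof -
    from that have "\<exists>l. l \<in> nbh E s \<and> leaf E l" by (auto simp: reduced_supports_def support_def)
    from someI_ex[OF this] show ?thesis using that by (simp add: g_def)
  qed
  \<comment> \<open>Such \<open>s\<close> and \<open>t\<close> would form a K2 with both ends kept,
    whereas the larger end is dropped. This settles the cases of injectivity in which exactly one of
    the two supports lies in \<open>D\<close>.\<close>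
  have clash: False if "s \<in> reduced_supports V E" "t \<in> reduced_supports V E" "s \<in> nbh E t" "leaf E s" for s t
  proof -
    have "nbh E s = {t}" using leaf_nbh[OF \<open>leaf E s\<close>] that nbh_sym by blast
    then have "leaf E t" using that by (auto simp: reduced_supports_def support_def)
    moreover have "s \<noteq> t" using that nbh_irrefl by metis
    ultimately show False
      using that nbh_sym[of s t] by (auto simp: reduced_supports_def neq_iff)
  qed
  show "inj_on g (reduced_supports V E)"
  proof (rule inj_onI)
    fix s t assume st: "s \<in> reduced_supports V E" "t \<in> reduced_supports V E" and eq: "g s = g t"
    consider "s \<in> D" "t \<in> D" | "s \<in> D" "t \<notin> D" | "s \<notin> D" "t \<in> D" | "s \<notin> D" "t \<notin> D" by blast
    then show "s = t"
    proof cases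
      case 1 then show ?thesis using eq by (simp add: g_def)
    next
      case 2 then show ?thesis using clash[of s t] g[of t] st eq by (simp add: g_def)
    next
      case 3 then show ?thesis using clash[of t s] g[of s] st eq by (simp add: g_def)
    next
      case 4
      have "nbh E (g s) = {s}" using g[OF st(1) 4(1)] leaf_nbh nbh_sym by blast
      moreover have "nbh E (g s) = {t}" using g[OF st(2) 4(2)] leaf_nbh nbh_sym eq by metis
      ultimately show ?thesis by simp
    qed
  qed
  show "g ` reduced_supports V E \<subseteq> D - core V E"
  proof clarify
    fix s assume s: "s \<in> reduced_supports V E"
    show "g s \<in> D - core V E"
    proof (cases "s \<in> D")
      case True then show ?thesis using s reduced_supports_not_core by (auto simp: g_def)
    next
      case False
      have gs: "nbh E (g s) = {s}" "leaf E (g s)" using g[OF s False] leaf_nbh nbh_sym by blast+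
      have "g s \<in> V" using g[OF s False] nbh_in_V by blast
      then have "g s \<in> D" using D gs False by (auto simp: dominating_iff)
      then show ?thesis using gs by (simp add: core_def)
    qed
  qed
  show "finite (D - core V E)"
    using D finite_V by (auto simp: dominating_iff intro: finite_subset)
qed

text \<open>An uncovered edge contains no non-leaf support, so its ends are both leaves or both in
  the core. The former is a K2, one end of which is kept; the latter contradicts
  \<open>ind\<close>.\<close>

lemma covering_reduced:
  assumes X: "X \<subseteq> core V E" and ind: "\<And>u v. u \<in> core V E \<Longrightarrow> v \<in> core V E \<Longrightarrow> u \<in> nbh E v \<Longrightarrow> u \<in> X \<or> v \<in> X"
  shows "covering_set V E (reduced_supports V E \<union> X)"
proof -
  have "u \<in> reduced_supports V E \<union> X"
    if v: "v \<notin> reduced_supports V E \<union> X" and uv: "u \<in> nbh E v" for u v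
  proof (rule ccontr)
    assume u: "u \<notin> reduced_supports V E \<union> X"
    have vu: "v \<in> nbh E u" using uv nbh_sym by blast
    have V: "u \<in> V" "v \<in> V" using uv nbh_in_V by auto
    have leaf_iff: "leaf E u \<longleftrightarrow> leaf E v"
      using u v uv vu support_in_reduced by (auto simp: support_def)
    show False
    proof (cases "leaf E u")
      case True
      then have L: "leaf E u" "leaf E v" using leaf_iff by auto
      then have "support E u" "support E v" using uv vu by (auto simp: support_def)
      \<comment> \<open>A leaf support is dropped only for a smaller leaf neighbour, and each of
        \<open>u\<close>, \<open>v\<close> has only the other as neighbour.\<close>
      then have "v < u" "u < v"
        using u v V L leaf_nbh[OF L(1) vu] leaf_nbh[OF L(2) uv]
        by (auto simp: reduced_supports_def)
      then show False by simp
    next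
      case False
      then have "\<not> support E u" "\<not> support E v" using leaf_iff u v support_in_reduced by auto
      then have "u \<in> core V E" "v \<in> core V E" using V False leaf_iff by (auto simp: core_def)
      then show False using ind uv u v by blast
    qed
  qed
  moreover have "reduced_supports V E \<union> X \<subseteq> V"
    using X by (auto simp: reduced_supports_def core_def)
  ultimately show ?thesis by (auto simp: covering_iff)
qed

section \<open>Equality of the two numbers and admissible colourings\<close>

text \<open>
  Each \<open>u \<in> U\<close> splits weight 1 evenly among its neighbours in \<open>X\<close>; then every \<open>x \<in> X\<close> collects at
  least 1, either from a \<open>u\<close> seeing only \<open>x\<close> or one half from each of two twins.
\<close>

lemma card_le_by_discharging:
  fixes X U :: "'a set"
  assumes fin: "finite X" "finite U"
    and dom: "\<And>x. x \<in> X \<Longrightarrow> \<exists>u\<in>U. x \<in> nbh E u"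
    and pair: "\<And>u x y. u \<in> U \<Longrightarrow> x \<in> X \<Longrightarrow> y \<in> X \<Longrightarrow> x \<noteq> y \<Longrightarrow> x \<in> nbh E u \<Longrightarrow> y \<in> nbh E u \<Longrightarrow>
      \<exists>a\<in>U. \<exists>b\<in>U. a \<noteq> b \<and> nbh E a = {x, y} \<and> nbh E b = {x, y}"
  shows "card X \<le> card U"
proof -
  \<comment> \<open>For \<open>u\<close> without neighbours in \<open>X\<close> this is
    \<open>1 / 0 = 0\<close>; no \<open>x\<close> receives anything from such a \<open>u\<close>, so
    the default is harmless.\<close>
  define w where "w u = 1 / real (card (nbh E u \<inter> X))" for u
  have "real (card X) = (\<Sum>x\<in>X. 1)" by simp
  also have "\<dots> \<le> (\<Sum>x\<in>X. \<Sum>u | u \<in> U \<and> x \<in> nbh E u. w u)"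
  proof (rule sum_mono)
    fix x assume x: "x \<in> X"
    obtain u where u: "u \<in> U" "x \<in> nbh E u" using dom x by blast
    have w0: "w v \<ge> 0" for v by (simp add: w_def)
    show "1 \<le> (\<Sum>u | u \<in> U \<and> x \<in> nbh E u. w u)"
    proof (cases "nbh E u \<inter> X = {x}")
      case True
      then have "1 = (\<Sum>v\<in>{u}. w v)" by (simp add: w_def)
      also have "\<dots> \<le> (\<Sum>u | u \<in> U \<and> x \<in> nbh E u. w u)"
        by (rule sum_mono2) (use u fin w0 in auto)
      finally show ?thesis .
    next
      case False
      then obtain y where y: "y \<in> X" "y \<noteq> x" "y \<in> nbh E u" using x u by blast
      obtain a b where ab: "a \<in> U" "b \<in> U" "a \<noteq> b" "nbh E a = {x, y}" "nbh E b = {x, y}"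
        using pair[OF u(1) x y(1) _ u(2) y(3)] y by metis
      have "{x, y} \<inter> X = {x, y}" using x y by auto
      then have "1 = (\<Sum>v\<in>{a, b}. w v)" using ab y by (simp add: w_def)
      also have "\<dots> \<le> (\<Sum>u | u \<in> U \<and> x \<in> nbh E u. w u)"
        by (rule sum_mono2) (use ab fin w0 in auto)
      finally show ?thesis .
    qed
  qed
  also have "\<dots> = (\<Sum>u\<in>U. \<Sum>x | x \<in> X \<and> x \<in> nbh E u. w u)"
    by (rule sum.swap_restrict) (use fin in auto)
  also have "\<dots> \<le> (\<Sum>u\<in>U. 1)"
  proof (rule sum_mono)
    fix u
    have "{x \<in> X. x \<in> nbh E u} = nbh E u \<inter> X" by auto
    then show "(\<Sum>x | x \<in> X \<and> x \<in> nbh E u. w u) \<le> 1" by (simp add: w_def)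
  qed
  finally show ?thesis by simp
qed

text \<open>A minimum dominating set \<open>D\<close> is compared with \<open>C\<close> separately
  outside and inside the core; inside, \<open>D \<inter> core V E - X\<close> discharges to
  \<open>X - D\<close>. The constraints on \<open>f\<close> supply what this needs: a dominator of
  \<open>x \<in> X - D\<close> is neither leaf nor support and has the opposite colour, hence is not
  crowded.\<close>

lemma covering_le_domination:
  assumes f: "admissible V E f"
  shows "covering_number V E \<le> domination_number V E"
proof -
  define X where "X = {v\<in>core V E. f v}"
  define C where "C = reduced_supports V E \<union> X"
  have fD: "\<And>v s. v \<in> X \<Longrightarrow> s \<in> nbh E v \<Longrightarrow> \<not> support E s"
    "\<And>v. v \<in> core V E \<Longrightarrow> crowded V E v \<Longrightarrow> v \<in> X"
    "\<And>u v. v \<in> core V E \<Longrightarrow> u \<in> core V E \<Longrightarrow> u \<in> nbh E v \<Longrightarrow> u \<in> X \<longleftrightarrow> v \<notin> X"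
    using f by (auto simp: admissible_def X_def)
  have "covering_set V E C"
    unfolding C_def by (rule covering_reduced) (use fD in \<open>auto simp: X_def\<close>)
  then have "covering_number V E \<le> card C" by (rule covering_number_le)
  moreover obtain D where D: "dominating_set V E D" "card D = domination_number V E"
    by (rule domination_number_attained)
  have fin: "finite D" "finite X" "D \<subseteq> V"
    using D finite_V by (auto simp: dominating_iff X_def core_def intro: finite_subset)
  have "card (X - D) \<le> card (D \<inter> core V E - X)"
  proof (rule card_le_by_discharging)
    show "\<exists>u\<in>D \<inter> core V E - X. x \<in> nbh E u" if x: "x \<in> X - D" for x
    proof -
      have "x \<in> V" "x \<in> core V E" using x by (auto simp: X_def core_def)
      then obtain u where u: "u \<in> nbh E x" "u \<in> D" using D x by (auto simp: dominating_iff)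
      then have "u \<in> core V E" using core_nbhD[OF \<open>x \<in> core V E\<close>] fD(1)[of x u] x by blast
      then show ?thesis using u x fD(3)[OF \<open>x \<in> core V E\<close> _ u(1)] nbh_sym by blast
    qed
    show "\<exists>a\<in>D \<inter> core V E - X. \<exists>b\<in>D \<inter> core V E - X. a \<noteq> b \<and> nbh E a = {x, y} \<and> nbh E b = {x, y}"
      if u: "u \<in> D \<inter> core V E - X" and xy: "x \<in> X - D" "y \<in> X - D" "x \<noteq> y" "x \<in> nbh E u" "y \<in> nbh E u" for u x y
    proof -
      have "\<not> crowded V E u" using fD(2) u by blast
      then have "\<not> card (twins E x y) < 2"
        using xy unfolding crowded_def X_def by blast
      then have "2 \<le> card (twins E x y)" by simp
      then obtain T where "T \<subseteq> twins E x y" "card T = 2"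
        by (meson obtain_subset_with_card_n)
      then obtain a b where ab: "a \<in> twins E x y" "b \<in> twins E x y" "a \<noteq> b"
        by (auto simp: card_2_iff)
      \<comment> \<open>A twin has no neighbours besides \<open>x\<close> and \<open>y\<close>, both
        outside \<open>D\<close>, so it can only be dominated by being in \<open>D\<close>
        itself.\<close>
      have "a \<in> D \<inter> core V E - X" if a: "nbh E a = {x, y}" for a
      proof -
        have "a \<in> V" using a nbh_in_V by blast
        then have "a \<in> D" using D a xy by (auto simp: dominating_iff)
        have ax: "a \<in> nbh E x" using a nbh_sym by blast
        have xc: "x \<in> core V E" using xy by (simp add: X_def)
        have "a \<in> core V E" using core_nbhD[OF xc ax] fD(1)[of x a] ax xy by blast
        then show ?thesis using \<open>a \<in> D\<close> fD(3)[OF xc _ ax] xy by blast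
      qed
      then show ?thesis using ab by (auto simp: twins_def)
    qed
  qed (use fin in auto)
  then have "card X \<le> card (D \<inter> core V E)"
  proof -
    assume le: "card (X - D) \<le> card (D \<inter> core V E - X)"
    have "card X = card (X - D) + card (X \<inter> D)"
      using card_Int_Diff[of X D] fin by simp
    also have "\<dots> \<le> card (D \<inter> core V E - X) + card (D \<inter> core V E \<inter> X)"
      by (intro add_mono[OF le] card_mono) (use fin in \<open>auto simp: X_def\<close>)
    also have "\<dots> = card (D \<inter> core V E)"
      using card_Int_Diff[of "D \<inter> core V E" X] fin by simp
    finally show ?thesis .
  qed
  moreover have "card (reduced_supports V E) \<le> card (D - core V E)"
    using D card_reduced_supports_le by blast
  moreover have "card D = card (D - core V E) + card (D \<inter> core V E)"
    using card_Int_Diff[of D "core V E"] fin by simp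
  moreover have "card C \<le> card (reduced_supports V E) + card X"
    unfolding C_def by (rule card_Un_le)
  ultimately show ?thesis using D by linarith
qed

text \<open>The part of a minimum covering outside the core is exchanged for the kept supports; the
  result still covers, and is no larger because a covering dominates. Each violated constraint then
  yields a dominating set smaller than \<open>C\<close>, or an uncovered edge.\<close>

lemma admissible_if_equal:
  assumes eq: "domination_number V E = covering_number V E"
  shows "\<exists>f. admissible V E f"
proof -
  obtain C0 where C0: "covering_set V E C0" "card C0 = covering_number V E"
    by (rule covering_number_attained)
  define X where "X = C0 \<inter> core V E"
  define C where "C = reduced_supports V E \<union> X"
  have cov: "covering_set V E C"
    unfolding C_def
    by (rule covering_reduced) (use C0 in \<open>auto simp: X_def covering_iff\<close>)
  have finC: "finite C" "finite C0"
    using cov C0 finite_V by (auto simp: covering_iff intro: finite_subset)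
  have "card C \<le> card (C0 - core V E) + card X"
    using card_Un_le[of "reduced_supports V E" X] card_reduced_supports_le[OF covering_dominating[OF C0(1)]]
    by (simp add: C_def)
  also have "\<dots> = card C0"
    using card_Int_Diff[of C0 "core V E"] finC by (simp add: X_def)
  finally have minC: "\<not> dominating_set V E D" if "card D < card C" for D
    using domination_number_le[of D] that C0 eq by linarith
  have CV: "C \<subseteq> V" using cov by (simp add: covering_iff)
  have core_C: "v \<in> C \<longleftrightarrow> v \<in> X" if "v \<in> core V E" for v
    using that reduced_supports_not_core by (auto simp: C_def)
  have no_nbr: "u \<notin> C" if v: "v \<in> X" and uv: "u \<in> nbh E v" for u v
  proof
    assume uC: "u \<in> C"
    have vc: "v \<in> core V E" "v \<in> C" using v by (auto simp: X_def C_def)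
    \<comment> \<open>\<open>v\<close> itself is dominated by \<open>u\<close>. A vertex outside
      \<open>C\<close> has all its neighbours in \<open>C\<close>, and they are not just
      \<open>v\<close>, because a core vertex has no leaf neighbour.\<close>
    have "dominating_set V E (C - {v})"
      unfolding dominating_iff
    proof (intro conjI ballI)
      fix z assume z: "z \<in> V - (C - {v})"
      show "nbh E z \<inter> (C - {v}) \<noteq> {}"
      proof (cases "z = v")
        case True then show ?thesis using uC uv nbh_irrefl by auto
      next
        case False
        then have zC: "z \<notin> C" "nbh E z \<subseteq> C" using z cov by (auto simp: covering_iff)
        moreover have "nbh E z \<noteq> {v}"
        proof
          assume "nbh E z = {v}"
          then have "leaf E z" "z \<in> nbh E v" using leafI nbh_sym by blast+
          then show False using vc by (auto simp: core_def support_def)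
        qed
        moreover have "nbh E z \<noteq> {}" using z nbh_nonempty by simp
        ultimately show ?thesis by blast
      qed
    qed (use CV in auto)
    moreover have "card (C - {v}) < card C"
      using finC vc by (intro psubset_card_mono) auto
    ultimately show False using minC by blast
  qed
  have "v \<in> X" if v: "v \<in> core V E" "crowded V E v" for v
  proof (rule ccontr)
    assume vX: "v \<notin> X"
    then have vC: "v \<notin> C" using core_C v by blast
    from v obtain x y where xy: "x \<in> nbh E v" "y \<in> nbh E v" "x \<in> core V E" "y \<in> core V E" "x \<noteq> y"
      and few: "card (twins E x y) < 2" unfolding crowded_def by blast
    have xyC: "x \<in> C" "y \<in> C" using vC xy cov by (auto simp: covering_iff)
    have fint: "finite (twins E x y)"
      by (rule finite_subset[OF _ finite_V]) (use nbh_in_V(2) in \<open>fastforce simp: twins_def\<close>)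
    \<comment> \<open>\<open>t\<close> is the twin of \<open>x\<close> and \<open>y\<close> if there
      is one, and otherwise \<open>v\<close>. It dominates both \<open>x\<close> and
      \<open>y\<close>, and putting it into \<open>D\<close> also settles the only vertex that might
      have all its neighbours in \<open>{x, y}\<close>.\<close>
    obtain t where t: "x \<in> nbh E t" "y \<in> nbh E t" "t \<in> V" "twins E x y \<subseteq> {t}"
    proof (cases "twins E x y = {}")
      case True
      then show ?thesis using that xy v by (auto simp: core_def)
    next
      case False
      then have "card (twins E x y) = 1" using few fint by (metis One_nat_def Suc_1 card_0_eq less_2_cases)
      then obtain t where "twins E x y = {t}" by (auto simp: card_1_singleton_iff)
      then show ?thesis using that[of t] nbh_in_V by (auto simp: twins_def)
    qed
    define D where "D = insert t (C - {x, y})"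
    have "dominating_set V E D"
      unfolding dominating_iff
    proof (intro conjI ballI)
      fix z assume z: "z \<in> V - D"
      show "nbh E z \<inter> D \<noteq> {}"
      proof (cases "z = x \<or> z = y")
        case True then show ?thesis using t nbh_sym by (auto simp: D_def)
      next
        case False
        then have zC: "z \<notin> C" "nbh E z \<subseteq> C" "z \<noteq> t" using z cov by (auto simp: covering_iff D_def)
        have "nbh E z \<noteq> {a}" if "a \<in> core V E" for a
        proof
          assume "nbh E z = {a}"
          then have "leaf E z" "z \<in> nbh E a" using leafI nbh_sym by blast+
          then show False using that by (auto simp: core_def support_def)
        qed
        then have "nbh E z \<noteq> {x}" "nbh E z \<noteq> {y}" using xy by auto
        moreover have "nbh E z \<noteq> {x, y}" using t zC by (auto simp: twins_def)
        moreover have "nbh E z \<noteq> {}" using z nbh_nonempty by simp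
        ultimately have "\<not> nbh E z \<subseteq> {x, y}" by blast
        then show ?thesis using zC by (auto simp: D_def)
      qed
    qed (use CV t in \<open>auto simp: D_def\<close>)
    moreover have "card D < card C"
    proof -
      have "card (C - {x, y}) = card C - 2" using finC xyC xy by (subst card_Diff_subset) auto
      moreover have "card {x, y} \<le> card C" using finC xyC by (intro card_mono) auto
      moreover have "card D \<le> Suc (card (C - {x, y}))" by (simp add: D_def card_insert_if finC)
      ultimately show ?thesis using xy by simp
    qed
    ultimately show False using minC by blast
  qed
  moreover have "\<not> v \<in> X" if "v \<in> core V E" "s \<in> nbh E v" "support E s" for v s
    using that no_nbr[of v s] core_nbhD[OF that(1,2)] support_in_reduced by (auto simp: C_def)
  moreover have "u \<in> X \<longleftrightarrow> v \<notin> X" if "v \<in> core V E" "u \<in> nbh E v" "u \<in> core V E" for u v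
    using that no_nbr[of v u] core_C cov by (auto simp: covering_iff)
  ultimately have "admissible V E (\<lambda>v. v \<in> X)"
    unfolding admissible_def by blast
  then show ?thesis by blast
qed

theorem equal_iff_admissible:
  "domination_number V E = covering_number V E \<longleftrightarrow> (\<exists>f. admissible V E f)"
  using admissible_if_equal covering_le_domination domination_le_covering by (meson le_antisym)

end

section \<open>Counting the pairs that have two twins\<close>

definition second_of :: "'a::linorder set \<Rightarrow> 'a \<Rightarrow> bool" where
  "second_of W w \<longleftrightarrow> w \<in> W \<and> card {x\<in>W. x < w} = 1"

text \<open>If \<open>w < z\<close>, then \<open>w\<close> and its predecessor in \<open>W\<close>
  both lie below \<open>z\<close>, which is one too many.\<close>

lemma second_of_unique:
  assumes "finite W" "second_of W w" "second_of W z"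
  shows "w = z"
proof -
  have False if "w < z" "second_of W w" "second_of W z" for w z
  proof -
    have "insert w {x\<in>W. x < w} \<subseteq> {x\<in>W. x < z}"
      using that by (auto simp: second_of_def)
    then have "card (insert w {x\<in>W. x < w}) \<le> card {x\<in>W. x < z}"
      using assms by (intro card_mono) auto
    moreover have "card (insert w {x\<in>W. x < w}) = 2"
      using that assms by (subst card_insert_disjoint) (auto simp: second_of_def)
    ultimately show False using that by (simp add: second_of_def)
  qed
  then show ?thesis using assms by (meson neq_iff)
qed

lemma ex_second_of:
  assumes fin: "finite W"
  shows "(\<exists>w. second_of W w) \<longleftrightarrow> 2 \<le> card W"
proof
  assume "\<exists>w. second_of W w"
  then obtain w where w: "w \<in> W" "card {x\<in>W. x < w} = 1" by (auto simp: second_of_def)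
  have "card (insert w {x\<in>W. x < w}) \<le> card W"
    using w fin by (intro card_mono) auto
  then show "2 \<le> card W" using w fin by (subst (asm) card_insert_disjoint) auto
next
  assume two: "2 \<le> card W"
  then have W: "W \<noteq> {}" by auto
  define a where "a = Min W"
  have a: "a \<in> W" "\<And>x. x \<in> W \<Longrightarrow> a \<le> x" using W fin by (auto simp: a_def)
  have "card (W - {a}) = card W - 1" using a fin by simp
  then have W': "W - {a} \<noteq> {}" using two by (metis card.empty diff_is_0_eq not_less_eq_eq numeral_2_eq_2 One_nat_def)
  define b where "b = Min (W - {a})"
  have b: "b \<in> W - {a}" "\<And>x. x \<in> W - {a} \<Longrightarrow> b \<le> x"
    unfolding b_def using W' fin by (intro Min_in; simp) (use fin in \<open>auto simp: b_def\<close>)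
  have "{x\<in>W. x < b} = {a}"
    using a b by (force simp: order_less_le)
  then show "\<exists>w. second_of W w" using b by (auto simp: second_of_def)
qed

lemma (in graph_without_isolated) twins_eq: "twins E x y = {z\<in>V. nbh E z = {x, y}}"
proof -
  have "z \<in> V" if "nbh E z = {x, y}" for z
    using nbh_in_V(2)[of x z] that by simp
  then show ?thesis unfolding twins_def by blast
qed

text \<open>
  The second vertex of each class of vertices with the same two neighbours represents that pair, so
  the set below counts the pairs that have two twins. This replaces a loop over all pairs of
  neighbours of \<open>u\<close>, which would be too slow.
\<close>

lemma (in graph_without_isolated) crowded_iff_count:
  "crowded V E u \<longleftrightarrow>
     card {w\<in>V. nbh E w \<subseteq> nbh E u \<inter> core V E \<and> card (nbh E w) = 2 \<and> second_of {z\<in>V. nbh E z = nbh E w} w}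
       < card (nbh E u \<inter> core V E) choose 2"
proof -
  define K where "K = nbh E u \<inter> core V E"
  define Pairs where "Pairs = {T. T \<subseteq> K \<and> card T = 2}"
  define Good where "Good = {T\<in>Pairs. 2 \<le> card {z\<in>V. nbh E z = T}}"
  define Reps where "Reps = {w\<in>V. nbh E w \<subseteq> K \<and> card (nbh E w) = 2 \<and> second_of {z\<in>V. nbh E z = nbh E w} w}"
  have finK: "finite K" using finite_nbh by (simp add: K_def)
  have fin: "finite {z\<in>V. nbh E z = T}" for T using finite_V by simp
  have finP: "finite Pairs" unfolding Pairs_def using finK by simp
  have "bij_betw (nbh E) Reps Good"
    unfolding bij_betw_def
  proof
    show "inj_on (nbh E) Reps"
    proof (rule inj_onI)
      fix w z assume "w \<in> Reps" "z \<in> Reps" "nbh E w = nbh E z"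
      then show "w = z" using second_of_unique[OF fin] by (auto simp: Reps_def)
    qed
    show "nbh E ` Reps = Good"
    proof (intro equalityI subsetI)
      fix T assume "T \<in> nbh E ` Reps"
      then obtain w where "T = nbh E w" "w \<in> Reps" by blast
      then show "T \<in> Good"
        using ex_second_of[OF fin, of T] by (auto simp: Reps_def Good_def Pairs_def)
    next
      fix T assume T: "T \<in> Good"
      then obtain w where "second_of {z\<in>V. nbh E z = T} w"
        using ex_second_of[OF fin, of T] by (auto simp: Good_def)
      moreover from this have "w \<in> V" "nbh E w = T" by (auto simp: second_of_def)
      ultimately have "w \<in> Reps" using T by (auto simp: Reps_def Good_def Pairs_def)
      then show "T \<in> nbh E ` Reps" using \<open>nbh E w = T\<close> by blast
    qed
  qed
  then have "card Reps = card Good" by (rule bij_betw_same_card)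
  moreover have "card Pairs = card K choose 2"
    unfolding Pairs_def using n_subsets[OF finK] by simp
  moreover have "card Good < card Pairs \<longleftrightarrow> Good \<noteq> Pairs"
    using finP by (auto simp: Good_def intro!: psubset_card_mono)
  moreover have "Good \<noteq> Pairs \<longleftrightarrow> crowded V E u"
  proof
    assume "Good \<noteq> Pairs"
    then obtain T where "T \<in> Pairs" "T \<notin> Good" by (auto simp: Good_def)
    then have T: "T \<subseteq> K" "card T = 2" "card {z\<in>V. nbh E z = T} < 2"
      by (auto simp: Good_def Pairs_def)
    then obtain x y where xy: "T = {x, y}" "x \<noteq> y" by (auto simp: card_2_iff)
    then have "twins E x y = {z\<in>V. nbh E z = T}"
      using twins_eq by simp
    then have "x \<in> K" "y \<in> K" "card (twins E x y) < 2" using T xy by simp_all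
    then show "crowded V E u" using xy(2) unfolding crowded_def K_def by blast
  next
    assume "crowded V E u"
    then obtain x y where xy: "x \<in> K" "y \<in> K" "x \<noteq> y" "card (twins E x y) < 2"
      by (auto simp: crowded_def K_def)
    have "{x, y} \<in> Pairs" "{x, y} \<notin> Good"
      using xy twins_eq[of x y] by (auto simp: Pairs_def Good_def)
    then show "Good \<noteq> Pairs" by blast
  qed
  ultimately show ?thesis unfolding Reps_def K_def by simp
qed

section \<open>Constrained 2-colouring in rounds\<close>

definition proper :: "'a set \<Rightarrow> ('a \<Rightarrow> 'a set) \<Rightarrow> ('a \<Rightarrow> bool) \<Rightarrow> ('a \<Rightarrow> bool) \<Rightarrow> ('a \<Rightarrow> bool) \<Rightarrow> bool" where
  "proper K N P Q f \<longleftrightarrow>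
     (\<forall>v\<in>K. (P v \<longrightarrow> \<not> f v) \<and> (Q v \<longrightarrow> f v) \<and> (\<forall>u\<in>N v \<inter> K. f u \<noteq> f v))"

text \<open>Colour 0 means not yet coloured, colour 1 stands for False and colour 2 for True.\<close>

definition advance ::
  "'a set \<Rightarrow> ('a \<Rightarrow> 'a set) \<Rightarrow> ('a \<Rightarrow> nat) \<times> ('a \<Rightarrow> nat) \<times> nat \<Rightarrow> ('a \<Rightarrow> nat) \<times> ('a \<Rightarrow> nat) \<times> nat \<Rightarrow> bool"
where
  "advance K N = (\<lambda>(c, d, x) (c', d', x').
     (\<forall>v\<in>K. d v \<noteq> 0) \<and> c' = c \<and> d' = d \<and> x' = x \<or>
     (\<exists>s\<in>K. \<exists>b. d s = 0 \<and> (c s \<noteq> 0 \<and> b = c \<or> (\<forall>v\<in>K. d v = 0 \<longrightarrow> c v = 0) \<and> b = c(s := 1)) \<and>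
        d' = d(s := 1) \<and> (x' = 0 \<longleftrightarrow> x = 0 \<and> (\<forall>v\<in>N s \<inter> K. b v \<noteq> b s)) \<and>
        (\<forall>v\<in>K. c' v = (if v \<in> N s \<and> b v = 0 then 3 - b s else b v))))"

locale colouring =
  fixes K :: "'a set" and N :: "'a \<Rightarrow> 'a set" and P Q :: "'a \<Rightarrow> bool"
  assumes finite_K: "finite K" and N_sym: "u \<in> N v \<Longrightarrow> v \<in> N u" and N_irrefl: "v \<notin> N v"
begin

text \<open>The last component counts conflicts: only its vanishing matters, and nothing is claimed
  after a conflict. A finished vertex (\<open>d v \<noteq> 0\<close>) has imposed the opposite
  colour \<open>3 - c v\<close> on all its neighbours in \<open>K\<close>.\<close>

definition sound :: "('a \<Rightarrow> nat) \<times> ('a \<Rightarrow> nat) \<times> nat \<Rightarrow> bool" where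
  "sound = (\<lambda>(c, d, x). x = 0 \<longrightarrow>
     (\<forall>v\<in>K. c v \<le> 2 \<and> (P v \<longrightarrow> c v = 1) \<and> (Q v \<longrightarrow> c v = 2) \<and>
        (d v \<noteq> 0 \<longrightarrow> c v \<noteq> 0 \<and> (\<forall>u\<in>N v \<inter> K. c u = 3 - c v))))"

text \<open>The completeness half: while a proper colouring exists, some such colouring agrees with
  all colours assigned so far. The witness is not fixed, because a free choice of colour may force a
  switch to another one.\<close>

definition extendable :: "('a \<Rightarrow> nat) \<times> ('a \<Rightarrow> nat) \<times> nat \<Rightarrow> bool" where
  "extendable = (\<lambda>(c, d, x). x = 0 \<and> (\<exists>f. proper K N P Q f \<and> (\<forall>v\<in>K. c v \<noteq> 0 \<longrightarrow> (c v = 2 \<longleftrightarrow> f v))))"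

text \<open>Nonzero colours never change, so earlier obligations persist. If \<open>s\<close> is
  finished without conflict, each of its neighbours in \<open>K\<close> was opposite already or is
  painted opposite now.\<close>

lemma sound_advance:
  assumes adv: "advance K N (c, d, x) (c', d', x')" and snd: "sound (c, d, x)"
  shows "sound (c', d', x')"
proof -
  consider "c' = c" "d' = d" "x' = x"
    | s b where "s \<in> K" "d s = 0" "c s \<noteq> 0 \<and> b = c \<or> (\<forall>v\<in>K. d v = 0 \<longrightarrow> c v = 0) \<and> b = c(s := 1)"
        "d' = d(s := 1)" "x' = 0 \<longleftrightarrow> x = 0 \<and> (\<forall>v\<in>N s \<inter> K. b v \<noteq> b s)"
        "\<forall>v\<in>K. c' v = (if v \<in> N s \<and> b v = 0 then 3 - b s else b v)"
    using adv unfolding advance_def by blast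
  then show ?thesis
  proof cases
    case 1 then show ?thesis using snd by simp
  next
    case 2
    show ?thesis
      unfolding sound_def prod.case
    proof (intro impI ballI)
      fix v assume "x' = 0" and v: "v \<in> K"
      then have x: "x = 0" and diff: "\<And>u. u \<in> N s \<Longrightarrow> u \<in> K \<Longrightarrow> b u \<noteq> b s" using 2 by auto
      have c: "\<And>v. v \<in> K \<Longrightarrow> c v \<le> 2 \<and> (P v \<longrightarrow> c v = 1) \<and> (Q v \<longrightarrow> c v = 2) \<and>
        (d v \<noteq> 0 \<longrightarrow> c v \<noteq> 0 \<and> (\<forall>u\<in>N v \<inter> K. c u = 3 - c v))" using snd x by (auto simp: sound_def)
      have bs: "b s \<noteq> 0" using 2 by auto
      have b2: "\<And>v. v \<in> K \<Longrightarrow> b v \<le> 2" using 2(3) c by (auto simp: fun_upd_apply)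
      have bc: "\<And>v. v \<in> K \<Longrightarrow> c v \<noteq> 0 \<Longrightarrow> b v = c v" using 2(1-3) by (auto simp: fun_upd_apply)
      have c'c: "\<And>v. v \<in> K \<Longrightarrow> c v \<noteq> 0 \<Longrightarrow> c' v = c v" using 2(6) bc by auto
      have c's: "c' s = b s" using 2(1,6) bs by auto
      have "c' v \<le> 2" using 2(6) v b2[OF v] bs by auto
      moreover have "P v \<longrightarrow> c' v = 1" "Q v \<longrightarrow> c' v = 2" using c[OF v] c'c[OF v] by auto
      moreover have "c' v \<noteq> 0 \<and> (\<forall>u\<in>N v \<inter> K. c' u = 3 - c' v)" if "d' v \<noteq> 0"
      proof (cases "v = s")
        case True
        have "c' u = 3 - b s" if u: "u \<in> N s" "u \<in> K" for u
        proof (cases "b u = 0")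
          case True then show ?thesis using 2(6) u by auto
        next
          case False
          then have "b u = 3 - b s" using diff[OF u] b2[OF u(2)] b2[OF 2(1)] bs by linarith
          then show ?thesis using 2(6) u False by auto
        qed
        then show ?thesis using True c's bs by auto
      next
        case False
        then have dv: "d v \<noteq> 0" using that 2 by auto
        have cv: "c v \<noteq> 0" "c v \<le> 2" using c[OF v] dv by auto
        have "c' u = 3 - c v" if u: "u \<in> N v" "u \<in> K" for u
        proof -
          have "c u = 3 - c v" using c[OF v] dv u by auto
          then show ?thesis using c'c[OF u(2)] cv by auto
        qed
        then show ?thesis using c'c[OF v] cv by auto
      qed
      ultimately show "c' v \<le> 2 \<and> (P v \<longrightarrow> c' v = 1) \<and> (Q v \<longrightarrow> c' v = 2) \<and>
        (d' v \<noteq> 0 \<longrightarrow> c' v \<noteq> 0 \<and> (\<forall>u\<in>N v \<inter> K. c' u = 3 - c' v))" by blast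
    qed
  qed
qed

lemma extendable_advance:
  assumes adv: "advance K N (c, d, x) (c', d', x')" and snd: "sound (c, d, x)" and ext: "extendable (c, d, x)"
  shows "extendable (c', d', x')"
proof -
  consider "c' = c" "d' = d" "x' = x"
    | s b where "s \<in> K" "d s = 0" "c s \<noteq> 0 \<and> b = c \<or> (\<forall>v\<in>K. d v = 0 \<longrightarrow> c v = 0) \<and> b = c(s := 1)"
        "d' = d(s := 1)" "x' = 0 \<longleftrightarrow> x = 0 \<and> (\<forall>v\<in>N s \<inter> K. b v \<noteq> b s)"
        "\<forall>v\<in>K. c' v = (if v \<in> N s \<and> b v = 0 then 3 - b s else b v)"
    using adv unfolding advance_def by blast
  then show ?thesis
  proof cases
    case 1 then show ?thesis using ext by simp
  next
    case 2
    obtain f where x: "x = 0" and f: "proper K N P Q f" "\<forall>v\<in>K. c v \<noteq> 0 \<longrightarrow> (c v = 2 \<longleftrightarrow> f v)"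
      using ext by (auto simp: extendable_def)
    have c: "\<And>v. v \<in> K \<Longrightarrow> c v \<le> 2 \<and> (P v \<longrightarrow> c v = 1) \<and> (Q v \<longrightarrow> c v = 2) \<and>
        (d v \<noteq> 0 \<longrightarrow> c v \<noteq> 0 \<and> (\<forall>u\<in>N v \<inter> K. c u = 3 - c v))" using snd x by (auto simp: sound_def)
    obtain g where g: "proper K N P Q g" "\<forall>v\<in>K. b v \<noteq> 0 \<longrightarrow> (b v = 2 \<longleftrightarrow> g v)"
    proof (cases "c s \<noteq> 0")
      case True
      then have "b = c" using 2 by auto
      then show ?thesis using that f by blast
    next
      case False
      then have new: "\<forall>v\<in>K. d v = 0 \<longrightarrow> c v = 0" "b = c(s := 1)" using 2 by auto
      \<comment> \<open>The uncoloured vertices are a union of components without unary constraints, so \<open>f\<close> may be flipped there.\<close>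
      define g where "g v = (if c v = 0 then f v \<noteq> f s else f v)" for v
      have "g u \<noteq> g v" if uv: "v \<in> K" "u \<in> K" "u \<in> N v" for u v
      proof -
        \<comment> \<open>By \<open>new(1)\<close> every coloured vertex is finished, and a finished
          vertex has only coloured neighbours in \<open>K\<close>.\<close>
        have closed: "c u \<noteq> 0" if "v \<in> K" "u \<in> K" "u \<in> N v" "c v \<noteq> 0" for u v
        proof -
          have "d v \<noteq> 0" using new(1) that by metis
          then have "c u = 3 - c v" using c that by blast
          then show ?thesis using c[OF that(1)] by auto
        qed
        have "c u = 0 \<longleftrightarrow> c v = 0" using closed uv N_sym by blast
        moreover have "f u \<noteq> f v" using f uv by (auto simp: proper_def)
        ultimately show ?thesis by (auto simp: g_def)
      qed
      \<comment> \<open>By soundness the vertices with \<open>P\<close> or \<open>Q\<close> are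
        coloured already, so they are outside the flipped part.\<close>
      then have "proper K N P Q g" using f c by (auto simp: proper_def g_def)
      moreover have "\<forall>v\<in>K. b v \<noteq> 0 \<longrightarrow> (b v = 2 \<longleftrightarrow> g v)"
        using f new False by (auto simp: g_def)
      ultimately show ?thesis using that by blast
    qed
    have bs: "b s \<noteq> 0" "b s \<le> 2" using 2 c[OF 2(1)] by auto
    have gs: "b s = 2 \<longleftrightarrow> g s" using g bs 2 by auto
    have gn: "g v \<noteq> g s" if "v \<in> N s" "v \<in> K" for v using g 2(1) that by (auto simp: proper_def)
    have "b v \<noteq> b s" if "v \<in> N s" "v \<in> K" for v
      using gn[OF that] g(2) that bs gs by auto
    then have "x' = 0" using 2 x by auto
    moreover have "c' v = 2 \<longleftrightarrow> g v" if v: "v \<in> K" "c' v \<noteq> 0" for v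
    proof (cases "v \<in> N s \<and> b v = 0")
      case True
      then have "c' v = 3 - b s" using 2 v by auto
      then show ?thesis using gn[of v] True v gs bs by auto
    next
      case False
      then have "c' v = b v" using 2 v by auto
      then show ?thesis using g v by auto
    qed
    ultimately show ?thesis using g by (auto simp: extendable_def)
  qed
qed

lemma undone_advance:
  assumes adv: "advance K N (c, d, x) (c', d', x')" and le: "card {v\<in>K. d v = 0} \<le> Suc m"
  shows "card {v\<in>K. d' v = 0} \<le> m"
proof -
  consider "\<forall>v\<in>K. d v \<noteq> 0" "d' = d" | s where "s \<in> K" "d s = 0" "d' = d(s := 1)"
    using adv unfolding advance_def by blast
  then show ?thesis
  proof cases
    case 1
    then have none: "{v\<in>K. d' v = 0} = {}" by blast
    show ?thesis unfolding none by simp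
  next
    case 2
    then have "{v\<in>K. d' v = 0} \<subset> {v\<in>K. d v = 0}" by auto
    then have "card {v\<in>K. d' v = 0} < card {v\<in>K. d v = 0}"
      using finite_K by (intro psubset_card_mono) auto
    then show ?thesis using le by simp
  qed
qed

lemma proper_if_all_done:
  assumes "sound (c, d, 0)" "\<forall>v\<in>K. d v \<noteq> 0"
  shows "proper K N P Q (\<lambda>v. c v = 2)"
  unfolding proper_def
proof (intro ballI conjI impI)
  fix v assume v: "v \<in> K"
  have c: "\<And>v. v \<in> K \<Longrightarrow> c v \<le> 2 \<and> (P v \<longrightarrow> c v = 1) \<and> (Q v \<longrightarrow> c v = 2) \<and>
        (c v \<noteq> 0 \<and> (\<forall>u\<in>N v \<inter> K. c u = 3 - c v))" using assms by (auto simp: sound_def)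
  show "P v \<Longrightarrow> c v \<noteq> 2" "Q v \<Longrightarrow> c v = 2" using c[OF v] by auto
  fix u assume u: "u \<in> N v \<inter> K"
  then have "c u = 3 - c v" using c[OF v] by auto
  then show "(c u = 2) \<noteq> (c v = 2)" using c[OF v] by auto
qed

text \<open>A vertex with both \<open>P\<close> and \<open>Q\<close> starts with the value 3, which
  is no colour; the last component is then nonzero, so \<open>sound\<close> holds trivially, and no
  proper colouring exists. In the end no vertex is unfinished, and the two invariants give the two
  directions.\<close>

lemma rounds_decide:
  assumes init: "\<And>v. v \<in> K \<Longrightarrow> fst (s 0) v = of_bool (P v) + 2 * of_bool (Q v)"
      "\<And>v. v \<in> K \<Longrightarrow> fst (snd (s 0)) v = 0" "snd (snd (s 0)) = 0 \<longleftrightarrow> (\<forall>v\<in>K. \<not> (P v \<and> Q v))"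
    and adv: "\<And>i. i < m \<Longrightarrow> advance K N (s i) (s (Suc i))"
    and m: "card K \<le> m"
  shows "snd (snd (s m)) = 0 \<longleftrightarrow> (\<exists>f. proper K N P Q f)"
proof -
  have inv: "sound (s i) \<and> ((\<exists>f. proper K N P Q f) \<longrightarrow> extendable (s i)) \<and>
      card {v\<in>K. fst (snd (s i)) v = 0} \<le> m - i" if "i \<le> m" for i
    using that
  proof (induction i)
    case 0
    obtain c d x where s: "s 0 = (c, d, x)" by (metis prod_cases3)
    have "sound (s 0)" using init by (auto simp: s sound_def)
    moreover have "extendable (s 0)" if "proper K N P Q f" for f
      using that init by (auto simp: s extendable_def proper_def intro!: exI[of _ f])
    moreover have "card {v\<in>K. fst (snd (s 0)) v = 0} \<le> m"
      using m card_mono[OF finite_K, of "{v\<in>K. fst (snd (s 0)) v = 0}"] by auto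
    ultimately show ?case by auto
  next
    case (Suc i)
    obtain c d x where s: "s i = (c, d, x)" by (metis prod_cases3)
    obtain c' d' x' where s': "s (Suc i) = (c', d', x')" by (metis prod_cases3)
    have a: "advance K N (c, d, x) (c', d', x')" using adv[of i] Suc.prems s s' by simp
    have "Suc (m - Suc i) = m - i" using Suc.prems by simp
    then show ?case
      using Suc.IH Suc.prems sound_advance[OF a] extendable_advance[OF a] undone_advance[OF a, of "m - Suc i"]
      by (auto simp: s s')
  qed
  obtain c d x where s: "s m = (c, d, x)" by (metis prod_cases3)
  have fin: "sound (c, d, x)" "(\<exists>f. proper K N P Q f) \<Longrightarrow> extendable (c, d, x)" "{v\<in>K. d v = 0} = {}"
    using inv[of m] finite_K s by auto
  show ?thesis
    using fin proper_if_all_done[of c d] unfolding s by (auto simp: extendable_def)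
qed

end

section \<open>A loop language and its compilation\<close>

definition code_at :: "program \<Rightarrow> nat \<Rightarrow> instr list \<Rightarrow> bool" where
  "code_at P p is \<longleftrightarrow> (\<exists>xs ys. P = xs @ is @ ys \<and> length xs = p)"

lemma code_at_append: "code_at P p (is @ js) \<longleftrightarrow> code_at P p is \<and> code_at P (p + length is) js"
proof (intro iffI conjI)
  assume "code_at P p (is @ js)"
  then obtain xs ys where "P = xs @ is @ js @ ys" "length xs = p"
    by (auto simp: code_at_def)
  then have "P = xs @ is @ (js @ ys) \<and> length xs = p" "P = (xs @ is) @ js @ ys \<and> length (xs @ is) = p + length is"
    by auto
  then show "code_at P p is" "code_at P (p + length is) js"
    unfolding code_at_def by blast+
next
  assume "code_at P p is \<and> code_at P (p + length is) js"
  then obtain xs ys xs' ys' where *: "P = xs @ is @ ys" "length xs = p"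
    "P = xs' @ js @ ys'" "length xs' = p + length is"
    unfolding code_at_def by blast
  then have "xs @ is = xs'"
    by (metis append_assoc append_eq_append_conv length_append)
  then have "P = xs @ (is @ js) @ ys'" using *(3) by (metis append_assoc)
  then show "code_at P p (is @ js)"
    unfolding code_at_def using * by blast
qed

lemma code_at_Cons: "code_at P p (i # is) \<longleftrightarrow> code_at P p [i] \<and> code_at P (Suc p) is"
  using code_at_append[of P p "[i]" "is"] by simp

lemma code_at_singleton: "code_at P p [i] \<longleftrightarrow> p < length P \<and> P ! p = i"
  unfolding code_at_def
  by (auto simp: nth_append) (metis append_Cons append_Nil id_take_nth_drop length_take min.absorb4 append_eq_conv_conj)

text \<open>At most \<open>t\<close> steps rather than exactly \<open>t\<close>, so that branches of
  different length can share one bound.\<close>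

definition reach :: "program \<Rightarrow> config \<Rightarrow> nat \<Rightarrow> config \<Rightarrow> bool" where
  "reach P c t c' \<longleftrightarrow> (\<exists>k\<le>t. (step P ^^ k) c = c')"

lemma reach_refl: "reach P c t c"
  unfolding reach_def by (rule exI[of _ 0]) simp

lemma reach_trans: "reach P c t c' \<Longrightarrow> reach P c' t' c'' \<Longrightarrow> reach P c (t + t') c''"
  unfolding reach_def
proof clarify
  fix k k' assume "k \<le> t" "k' \<le> t'"
  then show "\<exists>ka\<le>t + t'. (step P ^^ ka) c = (step P ^^ k') ((step P ^^ k) c)"
    by (intro exI[of _ "k' + k"]) (simp add: funpow_add)
qed

lemma reach_mono: "reach P c t c' \<Longrightarrow> t \<le> t' \<Longrightarrow> reach P c t' c'"
  unfolding reach_def using le_trans by blast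

lemma reach_step: "code_at P p [i] \<Longrightarrow> exec_instr i (Config p R M) = c' \<Longrightarrow> reach P (Config p R M) 1 c'"
  unfolding reach_def
  by (rule exI[of _ 1]) (auto simp: code_at_singleton step_def halted_def)

fun straight :: "instr \<Rightarrow> bool" where
  "straight (Jump l) = False"
| "straight (JumpZero i l) = False"
| "straight _ = True"

lemma pc_straight: "straight i \<Longrightarrow> pc (exec_instr i c) = Suc (pc c)"
  by (cases c; cases i) auto

lemma reach_straight:
  "code_at P (pc c) is \<Longrightarrow> list_all straight is \<Longrightarrow> reach P c (length is) (fold exec_instr is c)"
proof (induction "is" arbitrary: c)
  case Nil then show ?case by (simp add: reach_refl)
next
  case (Cons i "is")
  then have "code_at P (pc c) [i]" "code_at P (Suc (pc c)) is"
    using code_at_Cons by blast+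
  then have "reach P c 1 (exec_instr i c)"
    using reach_step[of P "pc c" i] by (cases c) auto
  moreover have "reach P (exec_instr i c) (length is) (fold exec_instr is (exec_instr i c))"
    by (rule Cons.IH) (use Cons.prems \<open>code_at P (Suc (pc c)) is\<close> pc_straight in auto)
  ultimately show ?case using reach_trans by fastforce
qed

section \<open>Loop language, compiler and cost\<close>

datatype exp =
    Num nat
  | Size
  | Plus exp exp
  | Minus exp exp
  | Arr nat exp
  | Inp exp

text \<open>\<open>For\<close> runs its variable from 0 to \<open>n - 1\<close>, and there is no
  other loop; so every command terminates and its cost is bounded by recursion on the
  syntax.\<close>

datatype com =
    Skip
  | Put nat exp exp
  | Seq com com
  | Cond exp com com
  | For nat com

type_synonym store = "nat \<Rightarrow> nat \<Rightarrow> nat"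

abbreviation Var :: "nat \<Rightarrow> exp" where
  "Var k \<equiv> Arr k (Num 0)"

text \<open>The bound 32 is the stride at which the arrays are interleaved in memory; being a power
  of two, it costs five doublings instead of a multiplication.\<close>

fun wf_exp :: "exp \<Rightarrow> bool" where
  "wf_exp (Num m) = True"
| "wf_exp Size = True"
| "wf_exp (Plus a b) = (wf_exp a \<and> wf_exp b)"
| "wf_exp (Minus a b) = (wf_exp a \<and> wf_exp b)"
| "wf_exp (Arr k a) = (k < 32 \<and> wf_exp a)"
| "wf_exp (Inp a) = wf_exp a"

fun writes :: "com \<Rightarrow> nat set" where
  "writes Skip = {}"
| "writes (Put k a b) = {k}"
| "writes (Seq c d) = writes c \<union> writes d"
| "writes (Cond e c d) = writes c \<union> writes d"
| "writes (For k c) = insert k (writes c)"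

text \<open>A loop body must not write the array holding its own counter; this guarantees exactly
  \<open>n\<close> rounds.\<close>

fun wf_com :: "com \<Rightarrow> bool" where
  "wf_com Skip = True"
| "wf_com (Put k a b) = (k < 32 \<and> wf_exp a \<and> wf_exp b)"
| "wf_com (Seq c d) = (wf_com c \<and> wf_com d)"
| "wf_com (Cond e c d) = (wf_exp e \<and> wf_com c \<and> wf_com d)"
| "wf_com (For k c) = (k < 32 \<and> k \<notin> writes c \<and> wf_com c)"

definition update :: "store \<Rightarrow> nat \<Rightarrow> nat \<Rightarrow> nat \<Rightarrow> store" where
  "update A k i x = A(k := (A k)(i := x))"

lemma update_apply: "update A k i x l = (if l = k then (A k)(i := x) else A l)"
  by (simp add: update_def)

lemma update_same: "update A k i x k i = x" "update (update A k i x) k i y = update A k i y"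
  by (simp_all add: update_def)

text \<open>
  Register 0 holds the number of vertices and register 1 the base address \<open>D\<close> of the arrays:
  cell \<open>i\<close> of array \<open>k < 32\<close> lives at address \<open>D + 32 * i + k\<close>, so that no two
  arrays overlap although none of them is bounded.
\<close>

definition address_code :: "nat \<Rightarrow> reg \<Rightarrow> reg \<Rightarrow> instr list" where
  "address_code k t u =
     [Add t t t, Add t t t, Add t t t, Add t t t, Add t t t, Const u k, Add t t u, Add t t 1]"

text \<open>The registers from \<open>t\<close> on serve as an evaluation stack: the value ends up
  in \<open>t\<close> and registers below \<open>t\<close> are preserved, so evaluating the second
  operand in \<open>Suc t\<close> leaves the first intact.\<close>

fun compile_exp :: "exp \<Rightarrow> reg \<Rightarrow> instr list" where
  "compile_exp (Num m) t = [Const t m]"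
| "compile_exp Size t = [Move t 0]"
| "compile_exp (Plus a b) t = compile_exp a t @ compile_exp b (Suc t) @ [Add t t (Suc t)]"
| "compile_exp (Minus a b) t = compile_exp a t @ compile_exp b (Suc t) @ [Sub t t (Suc t)]"
| "compile_exp (Arr k a) t = compile_exp a t @ address_code k t (Suc t) @ [Load t t]"
| "compile_exp (Inp a) t = compile_exp a t @ [Load t t]"

text \<open>The scratch register of the address computation is 4, so that the value waiting in
  register 3 survives.\<close>

definition compile_put :: "nat \<Rightarrow> exp \<Rightarrow> exp \<Rightarrow> instr list" where
  "compile_put k a b = compile_exp a 2 @ compile_exp b 3 @ address_code k 2 4 @ [Store 2 3]"

definition counter_init :: "nat \<Rightarrow> instr list" where
  "counter_init k = compile_put k (Num 0) (Num 0)"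

definition counter_test :: "nat \<Rightarrow> instr list" where
  "counter_test k = compile_exp (Minus Size (Var k)) 2"

definition counter_step :: "nat \<Rightarrow> instr list" where
  "counter_step k = compile_put k (Num 0) (Plus (Var k) (Num 1))"

text \<open>Independent of the position, so that \<open>compile\<close> can determine absolute jump
  targets beyond code that has not been generated yet.\<close>

fun code_size :: "com \<Rightarrow> nat" where
  "code_size Skip = 0"
| "code_size (Put k a b) = length (compile_put k a b)"
| "code_size (Seq c d) = code_size c + code_size d"
| "code_size (Cond e c d) = length (compile_exp e 2) + code_size c + code_size d + 2"
| "code_size (For k c) =
     length (counter_init k) + length (counter_test k) + code_size c + length (counter_step k) + 2"

fun compile :: "nat \<Rightarrow> com \<Rightarrow> instr list" where
  "compile p Skip = []"
| "compile p (Put k a b) = compile_put k a b"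
| "compile p (Seq c d) = compile p c @ compile (p + code_size c) d"
| "compile p (Cond e c d) =
     (let q = p + length (compile_exp e 2) + 1; r = q + code_size c + 1 in
      compile_exp e 2 @ [JumpZero 2 r] @ compile q c @ [Jump (r + code_size d)] @ compile r d)"
| "compile p (For k c) =
     (let q = p + length (counter_init k); r = q + length (counter_test k) + 1 in
      counter_init k @ counter_test k @ [JumpZero 2 (r + code_size c + length (counter_step k) + 1)] @
      compile r c @ counter_step k @ [Jump q])"

lemma length_compile [simp]: "length (compile p c) = code_size c"
  by (induction c arbitrary: p) (auto simp: Let_def)

text \<open>An upper bound depending on \<open>n\<close> alone: a conditional is charged for both
  branches, and a loop for \<open>n + 1\<close> tests, the last of which leaves it.\<close>

fun cost :: "nat \<Rightarrow> com \<Rightarrow> nat" where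
  "cost n Skip = 0"
| "cost n (Put k a b) = length (compile_put k a b)"
| "cost n (Seq c d) = cost n c + cost n d"
| "cost n (Cond e c d) = length (compile_exp e 2) + 2 + cost n c + cost n d"
| "cost n (For k c) = length (counter_init k) + (n + 1) * (length (counter_test k) + 1)
     + n * (cost n c + length (counter_step k) + 1)"

fun depth :: "com \<Rightarrow> nat" where
  "depth Skip = 0"
| "depth (Put k a b) = 0"
| "depth (Seq c d) = max (depth c) (depth d)"
| "depth (Cond e c d) = max (depth c) (depth d)"
| "depth (For k c) = Suc (depth c)"

text \<open>The base \<open>n + 1\<close> absorbs additive constants even for \<open>n = 0\<close>.
  Each loop contributes one factor.\<close>

lemma cost_le_power: "\<exists>K. \<forall>n. cost n c \<le> K * (n + 1) ^ depth c"
proof (induction c)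
  case Skip then show ?case by auto
next
  case (Put k a b) then show ?case by auto
next
  case (Seq c d)
  then obtain K L where KL: "\<And>n. cost n c \<le> K * (n + 1) ^ depth c" "\<And>n. cost n d \<le> L * (n + 1) ^ depth d"
    by blast
  have "cost n (Seq c d) \<le> (K + L) * (n + 1) ^ depth (Seq c d)" for n
  proof -
    have "cost n c \<le> K * (n + 1) ^ depth (Seq c d)"
      by (rule order.trans[OF KL(1)]) (intro mult_left_mono power_increasing, auto)
    moreover have "cost n d \<le> L * (n + 1) ^ depth (Seq c d)"
      by (rule order.trans[OF KL(2)]) (intro mult_left_mono power_increasing, auto)
    ultimately show ?thesis by (simp add: add_mult_distrib)
  qed
  then show ?case by blast
next
  case (Cond e c d)
  then obtain K L where KL: "\<And>n. cost n c \<le> K * (n + 1) ^ depth c" "\<And>n. cost n d \<le> L * (n + 1) ^ depth d"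
    by blast
  define H where "H = length (compile_exp e 2) + 2"
  have "cost n (Cond e c d) \<le> (H + K + L) * (n + 1) ^ depth (Cond e c d)" for n
  proof -
    have "cost n c \<le> K * (n + 1) ^ depth (Cond e c d)"
      by (rule order.trans[OF KL(1)]) (intro mult_left_mono power_increasing, auto)
    moreover have "cost n d \<le> L * (n + 1) ^ depth (Cond e c d)"
      by (rule order.trans[OF KL(2)]) (intro mult_left_mono power_increasing, auto)
    moreover have "H \<le> H * (n + 1) ^ depth (Cond e c d)" by simp
    moreover have "cost n (Cond e c d) = H + cost n c + cost n d" by (simp add: H_def)
    ultimately show ?thesis unfolding add_mult_distrib by linarith
  qed
  then show ?case by blast
next
  case (For k c)
  then obtain K where K: "\<And>n. cost n c \<le> K * (n + 1) ^ depth c" by blast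
  define H where "H = length (counter_init k) + (length (counter_test k) + 1) + (length (counter_step k) + 1)"
  have "cost n (For k c) \<le> (H + K) * (n + 1) ^ depth (For k c)" for n
  proof -
    have "cost n (For k c) \<le> (n + 1) * H + (n + 1) * cost n c"
      by (simp add: H_def algebra_simps)
    also have "\<dots> \<le> (n + 1) * (H * (n + 1) ^ depth c) + (n + 1) * (K * (n + 1) ^ depth c)"
      by (intro add_mono mult_left_mono K) auto
    finally show ?thesis by (simp add: algebra_simps)
  qed
  then show ?case by blast
qed

section \<open>Semantics and correctness of the compiler\<close>

locale ram =
  fixes n D :: nat and inp :: "nat \<Rightarrow> nat"
begin

text \<open>The input occupies the addresses below \<open>D\<close> and is never overwritten; the
  arrays fill everything from \<open>D\<close> on. They are total functions, so nothing needs to be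
  allocated.\<close>

definition layout :: "store \<Rightarrow> nat \<Rightarrow> nat" where
  "layout A a = (if a < D then inp a else A ((a - D) mod 32) ((a - D) div 32))"

fun eval :: "exp \<Rightarrow> store \<Rightarrow> nat" where
  "eval (Num m) A = m"
| "eval Size A = n"
| "eval (Plus a b) A = eval a A + eval b A"
| "eval (Minus a b) A = eval a A - eval b A"
| "eval (Arr k a) A = A k (eval a A)"
| "eval (Inp a) A = layout A (eval a A)"

text \<open>The last update in the \<open>For\<close> case mirrors the compiled loop, whose counter
  holds \<open>n\<close> on exit.\<close>

fun sem :: "com \<Rightarrow> store \<Rightarrow> store" where
  "sem Skip A = A"
| "sem (Put k a b) A = update A k (eval a A) (eval b A)"
| "sem (Seq c d) A = sem d (sem c A)"
| "sem (Cond e c d) A = (if eval e A = 0 then sem d A else sem c A)"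
| "sem (For k c) A = update (fold (\<lambda>j A. sem c (update A k 0 j)) [0..<n] A) k 0 n"

lemma sem_not_writes: "k \<notin> writes c \<Longrightarrow> sem c A k = A k"
proof (induction c arbitrary: A)
  case (For l c)
  have "fold (\<lambda>j A. sem c (update A l 0 j)) js A k = A k" for js
    using For by (induction js arbitrary: A) (auto simp: update_apply)
  then show ?case using For by (simp add: update_apply)
qed (auto simp: update_apply)

lemma layout_read: "k < 32 \<Longrightarrow> layout A (32 * i + k + D) = A k i"
  by (simp add: layout_def)

text \<open>Division with remainder by 32 recovers the array and the index from an address, so
  distinct cells never collide.\<close>

lemma layout_update: "k < 32 \<Longrightarrow> (layout A)(32 * i + k + D := x) = layout (update A k i x)"
proof (rule ext)
  fix a assume k: "k < 32"
  have "a = 32 * i + k + D \<longleftrightarrow> \<not> a < D \<and> (a - D) mod 32 = k \<and> (a - D) div 32 = i"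
    using k by auto
  then show "((layout A)(32 * i + k + D := x)) a = layout (update A k i x) a"
    by (auto simp: layout_def update_apply)
qed

definition reserved :: "(reg \<Rightarrow> nat) \<Rightarrow> bool" where
  "reserved R \<longleftrightarrow> R 0 = n \<and> R 1 = D"

lemma address_code_correct:
  assumes "code_at P p (address_code k t u)" "reserved R" "1 < t" "t < u"
  shows "\<exists>R'. reach P (Config p R M) (length (address_code k t u)) (Config (p + length (address_code k t u)) R' M)
    \<and> R' t = 32 * R t + k + D \<and> (\<forall>r. r \<noteq> t \<and> r \<noteq> u \<longrightarrow> R' r = R r)"
proof -
  have "list_all straight (address_code k t u)" by (simp add: address_code_def)
  from reach_straight[OF _ this, of P "Config p R M"] assms(1)
  have "reach P (Config p R M) (length (address_code k t u)) (fold exec_instr (address_code k t u) (Config p R M))"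
    by simp
  moreover obtain R' where "fold exec_instr (address_code k t u) (Config p R M) = Config (p + length (address_code k t u)) R' M"
    "R' t = 32 * R t + k + D \<and> (\<forall>r. r \<noteq> t \<and> r \<noteq> u \<longrightarrow> R' r = R r)"
    using assms(2-4) by (fastforce simp: address_code_def reserved_def)
  ultimately show ?thesis by metis
qed

lemma compile_exp_correct:
  assumes "code_at P p (compile_exp e t)" "reserved R" "1 < t" "wf_exp e"
  shows "\<exists>R'. reach P (Config p R (layout A)) (length (compile_exp e t)) (Config (p + length (compile_exp e t)) R' (layout A))
    \<and> R' t = eval e A \<and> (\<forall>r<t. R' r = R r)"
  using assms
proof (induction e arbitrary: p t R)
  case (Num m)
  then show ?case using reach_step[of P p "Const t m" R "layout A"] by fastforce
next
  case Size
  then show ?case using reach_step[of P p "Move t 0" R "layout A"] by (fastforce simp: reserved_def)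
next
  case (Plus a b)
  let ?a = "compile_exp a t" and ?b = "compile_exp b (Suc t)"
  have code: "code_at P p ?a" "code_at P (p + length ?a) ?b"
    "code_at P (p + length ?a + length ?b) [Add t t (Suc t)]"
    using Plus.prems(1) by (auto simp: code_at_append add.assoc)
  obtain R1 where R1: "reach P (Config p R (layout A)) (length ?a) (Config (p + length ?a) R1 (layout A))"
    "R1 t = eval a A" "\<forall>r<t. R1 r = R r"
    using Plus.IH(1)[OF code(1)] Plus.prems by auto
  then have "reserved R1" using Plus.prems by (simp add: reserved_def)
  then obtain R2 where R2: "reach P (Config (p + length ?a) R1 (layout A)) (length ?b) (Config (p + length ?a + length ?b) R2 (layout A))"
    "R2 (Suc t) = eval b A" "\<forall>r<Suc t. R2 r = R1 r"
    using Plus.IH(2)[OF code(2), of R1] Plus.prems by auto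
  from reach_trans[OF reach_trans[OF R1(1) R2(1)] reach_step[OF code(3) refl]]
  show ?case using R1 R2 by (auto simp: add.assoc intro!: exI)
next
  case (Minus a b)
  let ?a = "compile_exp a t" and ?b = "compile_exp b (Suc t)"
  have code: "code_at P p ?a" "code_at P (p + length ?a) ?b"
    "code_at P (p + length ?a + length ?b) [Sub t t (Suc t)]"
    using Minus.prems(1) by (auto simp: code_at_append add.assoc)
  obtain R1 where R1: "reach P (Config p R (layout A)) (length ?a) (Config (p + length ?a) R1 (layout A))"
    "R1 t = eval a A" "\<forall>r<t. R1 r = R r"
    using Minus.IH(1)[OF code(1)] Minus.prems by auto
  then have "reserved R1" using Minus.prems by (simp add: reserved_def)
  then obtain R2 where R2: "reach P (Config (p + length ?a) R1 (layout A)) (length ?b) (Config (p + length ?a + length ?b) R2 (layout A))"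
    "R2 (Suc t) = eval b A" "\<forall>r<Suc t. R2 r = R1 r"
    using Minus.IH(2)[OF code(2), of R1] Minus.prems by auto
  from reach_trans[OF reach_trans[OF R1(1) R2(1)] reach_step[OF code(3) refl]]
  show ?case using R1 R2 by (auto simp: add.assoc intro!: exI)
next
  case (Arr k a)
  let ?a = "compile_exp a t" and ?b = "address_code k t (Suc t)"
  have code: "code_at P p ?a" "code_at P (p + length ?a) ?b"
    "code_at P (p + length ?a + length ?b) [Load t t]"
    using Arr.prems(1) by (auto simp: code_at_append add.assoc)
  obtain R1 where R1: "reach P (Config p R (layout A)) (length ?a) (Config (p + length ?a) R1 (layout A))"
    "R1 t = eval a A" "\<forall>r<t. R1 r = R r"
    using Arr.IH[OF code(1)] Arr.prems by auto
  then have "reserved R1" using Arr.prems by (simp add: reserved_def)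
  then obtain R2 where R2: "reach P (Config (p + length ?a) R1 (layout A)) (length ?b) (Config (p + length ?a + length ?b) R2 (layout A))"
    "R2 t = 32 * R1 t + k + D" "\<forall>r. r \<noteq> t \<and> r \<noteq> Suc t \<longrightarrow> R2 r = R1 r"
    using address_code_correct[OF code(2), of R1] Arr.prems by auto
  from reach_trans[OF reach_trans[OF R1(1) R2(1)] reach_step[OF code(3) refl]]
  show ?case using R1 R2 Arr.prems layout_read[of k A] by (auto simp: add.assoc intro!: exI)
next
  case (Inp a)
  let ?a = "compile_exp a t"
  have code: "code_at P p ?a" "code_at P (p + length ?a) [Load t t]"
    using Inp.prems(1) by (auto simp: code_at_append)
  obtain R1 where R1: "reach P (Config p R (layout A)) (length ?a) (Config (p + length ?a) R1 (layout A))"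
    "R1 t = eval a A" "\<forall>r<t. R1 r = R r"
    using Inp.IH[OF code(1)] Inp.prems by auto
  from reach_trans[OF R1(1) reach_step[OF code(2) refl]]
  show ?case using R1 by (auto intro!: exI)
qed

text \<open>All registers except the two reserved ones are arbitrary: commands exchange data only
  through the store, so their runs compose freely.\<close>

definition runs :: "program \<Rightarrow> nat \<Rightarrow> store \<Rightarrow> nat \<Rightarrow> nat \<Rightarrow> store \<Rightarrow> bool" where
  "runs P p A t q B \<longleftrightarrow> (\<forall>R. reserved R \<longrightarrow>
     (\<exists>R'. reserved R' \<and> reach P (Config p R (layout A)) t (Config q R' (layout B))))"

lemma runs_refl: "runs P p A t p A"
  unfolding runs_def using reach_refl by blast

lemma runs_trans: "runs P p A t q B \<Longrightarrow> runs P q B t' r C \<Longrightarrow> runs P p A (t + t') r C"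
  unfolding runs_def using reach_trans by meson

lemma runs_mono: "runs P p A t q B \<Longrightarrow> t \<le> t' \<Longrightarrow> runs P p A t' q B"
  unfolding runs_def using reach_mono by meson

lemma runs_jump: "code_at P p [Jump l] \<Longrightarrow> runs P p A 1 l A"
  unfolding runs_def using reach_step by fastforce

lemma runs_test:
  assumes "code_at P p (compile_exp e 2 @ [JumpZero 2 l])" "wf_exp e"
  shows "runs P p A (length (compile_exp e 2) + 1) (if eval e A = 0 then l else p + length (compile_exp e 2) + 1) A"
  unfolding runs_def
proof (intro allI impI)
  fix R assume R: "reserved R"
  have code: "code_at P p (compile_exp e 2)" "code_at P (p + length (compile_exp e 2)) [JumpZero 2 l]"
    using assms by (auto simp: code_at_append)
  obtain R' where R': "reach P (Config p R (layout A)) (length (compile_exp e 2)) (Config (p + length (compile_exp e 2)) R' (layout A))"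
    "R' 2 = eval e A" "\<forall>r<2. R' r = R r"
    using compile_exp_correct[OF code(1) R _ assms(2), of A] by auto
  moreover have "reserved R'" using R R' by (simp add: reserved_def)
  ultimately show "\<exists>R'. reserved R' \<and> reach P (Config p R (layout A)) (length (compile_exp e 2) + 1)
     (Config (if eval e A = 0 then l else p + length (compile_exp e 2) + 1) R' (layout A))"
    using reach_trans[OF R'(1) reach_step[OF code(2) refl]] by auto
qed

lemma runs_put:
  assumes "code_at P p (compile_put k a b)" "k < 32" "wf_exp a" "wf_exp b"
  shows "runs P p A (length (compile_put k a b)) (p + length (compile_put k a b)) (update A k (eval a A) (eval b A))"
  unfolding runs_def
proof (intro allI impI)
  fix R assume R: "reserved R"
  let ?a = "compile_exp a 2" and ?b = "compile_exp b 3" and ?c = "address_code k 2 4"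
  have code: "code_at P p ?a" "code_at P (p + length ?a) ?b" "code_at P (p + length ?a + length ?b) ?c"
    "code_at P (p + length ?a + length ?b + length ?c) [Store 2 3]"
    using assms(1) by (auto simp: compile_put_def code_at_append add.assoc)
  obtain R1 where R1: "reach P (Config p R (layout A)) (length ?a) (Config (p + length ?a) R1 (layout A))"
    "R1 2 = eval a A" "\<forall>r<2. R1 r = R r"
    using compile_exp_correct[OF code(1) R _ assms(3), of A] by auto
  then have r1: "reserved R1" using R by (simp add: reserved_def)
  obtain R2 where R2: "reach P (Config (p + length ?a) R1 (layout A)) (length ?b) (Config (p + length ?a + length ?b) R2 (layout A))"
    "R2 3 = eval b A" "\<forall>r<3. R2 r = R1 r"
    using compile_exp_correct[OF code(2) r1 _ assms(4), of A] by auto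
  then have r2: "reserved R2" using r1 by (simp add: reserved_def)
  obtain R3 where R3: "reach P (Config (p + length ?a + length ?b) R2 (layout A)) (length ?c) (Config (p + length ?a + length ?b + length ?c) R3 (layout A))"
    "R3 2 = 32 * R2 2 + k + D" "\<forall>r. r \<noteq> 2 \<and> r \<noteq> 4 \<longrightarrow> R3 r = R2 r"
    using address_code_correct[OF code(3) r2, of "layout A"] by auto
  then have r3: "reserved R3" using r2 by (simp add: reserved_def)
  have "R3 2 = 32 * eval a A + k + D" "R3 3 = eval b A" using R1 R2 R3 by auto
  then have "(layout A)(R3 2 := R3 3) = layout (update A k (eval a A) (eval b A))"
    using layout_update[OF assms(2)] by simp
  then show "\<exists>R'. reserved R' \<and> reach P (Config p R (layout A)) (length (compile_put k a b))
     (Config (p + length (compile_put k a b)) R' (layout (update A k (eval a A) (eval b A))))"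
    using reach_trans[OF reach_trans[OF reach_trans[OF R1(1) R2(1)] R3(1)] reach_step[OF code(4) refl]] r3
    by (auto simp: compile_put_def add.assoc intro!: exI)
qed

lemma compile_correct:
  "code_at P p (compile p c) \<Longrightarrow> wf_com c \<Longrightarrow> runs P p A (cost n c) (p + code_size c) (sem c A)"
proof (induction c arbitrary: p A)
  case Skip then show ?case by (simp add: runs_refl)
next
  case (Put k a b) then show ?case using runs_put by simp
next
  case (Seq c d)
  have "runs P p A (cost n c) (p + code_size c) (sem c A)"
    using Seq by (simp add: code_at_append)
  moreover have "runs P (p + code_size c) (sem c A) (cost n d) (p + code_size c + code_size d) (sem d (sem c A))"
    using Seq by (simp add: code_at_append)
  ultimately show ?case using runs_trans by (fastforce simp: add.assoc)
next
  case (Cond e c d)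
  define q where "q = p + length (compile_exp e 2) + 1"
  define r where "r = q + code_size c + 1"
  have code: "code_at P p (compile_exp e 2 @ [JumpZero 2 r])" "code_at P q (compile q c)"
    "code_at P (q + code_size c) [Jump (r + code_size d)]" "code_at P r (compile r d)"
    using Cond.prems(1) unfolding compile.simps Let_def q_def[symmetric] r_def[symmetric] code_at_append
    by (auto simp: q_def r_def code_at_append add.assoc)
  have test: "runs P p A (length (compile_exp e 2) + 1) (if eval e A = 0 then r else q) A"
    using runs_test[OF code(1), of A] Cond.prems unfolding q_def by auto
  have fin: "p + code_size (Cond e c d) = r + code_size d" by (simp add: q_def r_def)
  show ?case
  proof (cases "eval e A = 0")
    case True
    have "runs P r A (cost n d) (r + code_size d) (sem d A)" using Cond code by simp
    then show ?thesis
      using runs_mono[OF runs_trans[OF test[unfolded if_P[OF True]]]] True unfolding fin by simp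
  next
    case False
    have "runs P q A (cost n c) (q + code_size c) (sem c A)" using Cond code by simp
    then have "runs P q A (cost n c + 1) (r + code_size d) (sem c A)"
      using runs_trans runs_jump[OF code(3)] by blast
    then show ?thesis
      using runs_mono[OF runs_trans[OF test[unfolded if_not_P[OF False]]]] False unfolding fin by simp
  qed
next
  case (For k c)
  define q where "q = p + length (counter_init k)"
  define r where "r = q + length (counter_test k) + 1"
  define s where "s = r + code_size c"
  define e where "e = s + length (counter_step k) + 1"
  have code: "code_at P p (counter_init k)" "code_at P q (counter_test k @ [JumpZero 2 e])"
    "code_at P r (compile r c)" "code_at P s (counter_step k)" "code_at P (s + length (counter_step k)) [Jump q]"
    using For.prems(1) unfolding compile.simps Let_def q_def[symmetric] r_def[symmetric] s_def[symmetric] e_def[symmetric] code_at_append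
    by (auto simp: q_def r_def s_def e_def code_at_append add.assoc)
  have k: "k < 32" "k \<notin> writes c" using For.prems by auto
  have init: "runs P p A (length (counter_init k)) q (update A k 0 0)" for A
    using runs_put[OF code(1)[unfolded counter_init_def], of A] k by (simp add: q_def counter_init_def)
  have test: "runs P q B (length (counter_test k) + 1) (if n - B k 0 = 0 then e else r) B" for B
    using runs_test[OF code(2)[unfolded counter_test_def], of B] k by (simp add: r_def counter_test_def split: if_split_asm)
  have body: "runs P r B (cost n c) s (sem c B)" for B
    using For.IH[OF code(3)] For.prems by (simp add: s_def)
  have incr: "runs P s B (length (counter_step k) + 1) q (update B k 0 (B k 0 + 1))" for B
  proof -
    have "runs P s B (length (counter_step k)) (s + length (counter_step k)) (update B k 0 (B k 0 + 1))"
      using runs_put[OF code(4)[unfolded counter_step_def], of B] k by (simp add: counter_step_def)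
    then show ?thesis using runs_trans runs_jump[OF code(5)] by blast
  qed
  define H where "H = length (counter_test k) + 1"
  define J where "J = cost n c + length (counter_step k) + 1"
  \<comment> \<open>Generalised to any entry value \<open>m\<close> and any store, for induction on
    \<open>n - m\<close>. \<open>H\<close> pays for a test, \<open>J\<close> for the body, the
    increment and the jump back.\<close>
  have loop: "runs P q (update B k 0 m) ((n - m + 1) * H + (n - m) * J) e
      (update (fold (\<lambda>j A. sem c (update A k 0 j)) [m..<n] B) k 0 n)" if "m \<le> n" for m B
    using that
  proof (induction "n - m" arbitrary: m B)
    case 0
    then show ?case using test[of "update B k 0 m"] by (simp add: update_same H_def)
  next
    case (Suc d)
    then have m: "m < n" by simp
    let ?B = "sem c (update B k 0 m)"
    have Bk: "?B k 0 = m" using k by (simp add: sem_not_writes update_apply)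
    have "runs P q (update B k 0 m) H r (update B k 0 m)"
      using test[of "update B k 0 m"] m by (simp add: update_same H_def)
    from runs_trans[OF runs_trans[OF this body] incr]
    have 1: "runs P q (update B k 0 m) (H + J) q (update ?B k 0 (Suc m))"
      using Bk by (simp add: J_def add.assoc)
    have "runs P q (update ?B k 0 (Suc m)) ((n - Suc m + 1) * H + (n - Suc m) * J) e
      (update (fold (\<lambda>j A. sem c (update A k 0 j)) [Suc m..<n] ?B) k 0 n)"
      using Suc.hyps(1)[of "Suc m"] Suc.hyps(2) m by simp
    from runs_trans[OF 1 this]
    have "runs P q (update B k 0 m) ((H + J) + ((n - Suc m + 1) * H + (n - Suc m) * J)) e
      (update (fold (\<lambda>j A. sem c (update A k 0 j)) [m..<n] B) k 0 n)"
      using m by (simp add: upt_conv_Cons)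
    moreover have "n - m = Suc (n - Suc m)" using m by simp
    then have "(n - m + 1) * H + (n - m) * J = (H + J) + ((n - Suc m + 1) * H + (n - Suc m) * J)"
      by simp
    ultimately show ?case by (simp only:)
  qed
  have "p + code_size (For k c) = e" by (simp add: q_def r_def s_def e_def)
  then show ?case
    using runs_trans[OF init loop[of 0 A]] by (simp add: H_def J_def algebra_simps)
qed

end

section \<open>The decision procedure\<close>

definition Neg :: "exp \<Rightarrow> exp" where
  "Neg a = Minus (Num 1) a"

definition Conj :: "exp \<Rightarrow> exp \<Rightarrow> exp" where
  "Conj a b = Neg (Plus (Neg a) (Neg b))"

text \<open>Truncated subtraction is the source of all comparisons: \<open>b - a\<close> is nonzero
  iff \<open>a < b\<close>, and the double \<open>Neg\<close> normalises it to 0 or 1.\<close>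

definition Less :: "exp \<Rightarrow> exp \<Rightarrow> exp" where
  "Less a b = Neg (Neg (Minus b a))"

definition Equal :: "exp \<Rightarrow> exp \<Rightarrow> exp" where
  "Equal a b = Neg (Plus (Minus a b) (Minus b a))"

lemma wf_exp_derived [simp]:
  "wf_exp (Neg a) = wf_exp a" "wf_exp (Conj a b) = (wf_exp a \<and> wf_exp b)"
  "wf_exp (Less a b) = (wf_exp a \<and> wf_exp b)" "wf_exp (Equal a b) = (wf_exp a \<and> wf_exp b)"
  by (auto simp: Neg_def Conj_def Less_def Equal_def)

definition Accumulate :: "nat \<Rightarrow> nat \<Rightarrow> exp \<Rightarrow> com" where
  "Accumulate x j e = For j (Put x (Num 0) (Plus (Var x) e))"

definition Count :: "nat \<Rightarrow> nat \<Rightarrow> exp \<Rightarrow> com" where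
  "Count x j e = Seq (Put x (Num 0) (Num 0)) (Accumulate x j e)"

text \<open>The value \<open>n\<close> stands for failure. There is no early exit, so later hits
  overwrite earlier ones and the largest hit remains.\<close>

definition Search :: "nat \<Rightarrow> nat \<Rightarrow> exp \<Rightarrow> com" where
  "Search x j e = Seq (Put x (Num 0) Size) (For j (Cond e (Put x (Num 0) (Var j)) Skip))"

definition Fill :: "nat \<Rightarrow> nat \<Rightarrow> com \<Rightarrow> exp \<Rightarrow> com" where
  "Fill k i c e = For i (Seq c (Put k (Var i) e))"

lemmas loop_defs = Accumulate_def Count_def Search_def Fill_def

lemma writes_loops [simp]:
  "writes (Accumulate x j e) = {x, j}" "writes (Count x j e) = {x, j}" "writes (Search x j e) = {x, j}"
  "writes (Fill k i c e) = insert i (insert k (writes c))"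
  by (auto simp: loop_defs)

lemma wf_loops [simp]:
  "wf_com (Accumulate x j e) = (x < 32 \<and> j < 32 \<and> x \<noteq> j \<and> wf_exp e)"
  "wf_com (Count x j e) = (x < 32 \<and> j < 32 \<and> x \<noteq> j \<and> wf_exp e)"
  "wf_com (Search x j e) = (x < 32 \<and> j < 32 \<and> x \<noteq> j \<and> wf_exp e)"
  "wf_com (Fill k i c e) = (k < 32 \<and> i < 32 \<and> i \<noteq> k \<and> i \<notin> writes c \<and> wf_com c \<and> wf_exp e)"
  by (auto simp: loop_defs)

lemma depth_loops [simp]:
  "depth (Accumulate x j e) = 1" "depth (Count x j e) = 1" "depth (Search x j e) = 1"
  "depth (Fill k i c e) = Suc (depth c)"
  by (auto simp: loop_defs)

context ram
begin

lemma eval_derived [simp]: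
  "eval (Neg a) A = of_bool (eval a A = 0)"
  "eval (Conj a b) A = of_bool (eval a A \<noteq> 0 \<and> eval b A \<noteq> 0)"
  "eval (Less a b) A = of_bool (eval a A < eval b A)"
  "eval (Equal a b) A = of_bool (eval a A = eval b A)"
  by (auto simp: Neg_def Conj_def Less_def Equal_def)

lemma for_inv:
  assumes "I 0 A" "\<And>j B. j < n \<Longrightarrow> I j B \<Longrightarrow> I (Suc j) (sem c (update B k 0 j))"
  obtains B where "I n B" "sem (For k c) A = update B k 0 n"
proof -
  have "I m (fold (\<lambda>j A. sem c (update A k 0 j)) [0..<m] A)" if "m \<le> n" for m
    using that by (induction m) (auto simp: assms)
  from this[of n] show ?thesis by (intro that) simp_all
qed

text \<open>The premise on \<open>e\<close> is an independence condition: its value may depend on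
  the counter and on arrays the loop leaves alone, but not on the running sum.\<close>

lemma accumulate:
  assumes xj: "x \<noteq> j"
    and e: "\<And>B v. v < n \<Longrightarrow> (\<And>k. k \<noteq> x \<Longrightarrow> k \<noteq> j \<Longrightarrow> B k = A k) \<Longrightarrow> B j 0 = v \<Longrightarrow> eval e B = f v"
  shows "sem (Accumulate x j e) A x 0 = A x 0 + (\<Sum>v<n. f v)"
proof -
  define I where "I m B \<longleftrightarrow> (\<forall>k. k \<noteq> x \<longrightarrow> k \<noteq> j \<longrightarrow> B k = A k) \<and> B x 0 = A x 0 + (\<Sum>v<m. f v)" for m B
  obtain B where "I n B" "sem (Accumulate x j e) A = update B j 0 n"
    unfolding Accumulate_def
  proof (rule for_inv[of I])
    show "I 0 A" by (simp add: I_def)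
    fix m B assume m: "m < n" and I: "I m B"
    let ?B = "update B j 0 m"
    have "eval e ?B = f m"
      by (rule e) (use m I in \<open>auto simp: I_def update_apply\<close>)
    then show "I (Suc m) (sem (Put x (Num 0) (Plus (Var x) e)) ?B)"
      using I xj by (auto simp: I_def update_apply)
  qed
  then show ?thesis using xj by (simp add: I_def update_apply)
qed

lemma count:
  assumes xj: "x \<noteq> j"
    and e: "\<And>B v. v < n \<Longrightarrow> (\<And>k. k \<noteq> x \<Longrightarrow> k \<noteq> j \<Longrightarrow> B k = A k) \<Longrightarrow> B j 0 = v \<Longrightarrow> eval e B = f v"
  shows "sem (Count x j e) A x 0 = (\<Sum>v<n. f v)"
proof -
  have "sem (Accumulate x j e) (update A x 0 0) x 0 = update A x 0 0 x 0 + (\<Sum>v<n. f v)"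
    by (rule accumulate[OF xj]) (auto intro: e simp: update_apply)
  then show ?thesis by (simp add: Count_def update_same)
qed

lemma count_card:
  assumes "x \<noteq> j"
    and "\<And>B v. v < n \<Longrightarrow> (\<And>k. k \<noteq> x \<Longrightarrow> k \<noteq> j \<Longrightarrow> B k = A k) \<Longrightarrow> B j 0 = v \<Longrightarrow> eval e B = of_bool (P v)"
  shows "sem (Count x j e) A x 0 = card {v. v < n \<and> P v}"
proof -
  have "sem (Count x j e) A x 0 = (\<Sum>v<n. of_bool (P v))"
    by (rule count) (use assms in auto)
  also have "\<dots> = card ({..<n} \<inter> {v. P v})"
    by simp
  also have "{..<n} \<inter> {v. P v} = {v. v < n \<and> P v}"
    by auto
  finally show ?thesis .
qed

lemma search:
  assumes xj: "x \<noteq> j"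
    and e: "\<And>B v. v < n \<Longrightarrow> (\<And>k. k \<noteq> x \<Longrightarrow> k \<noteq> j \<Longrightarrow> B k = A k) \<Longrightarrow> B j 0 = v \<Longrightarrow> eval e B \<noteq> 0 \<longleftrightarrow> P v"
  defines "r \<equiv> sem (Search x j e) A x 0"
  shows "r = n \<and> (\<forall>v<n. \<not> P v) \<or> r < n \<and> P r \<and> (\<forall>v<n. P v \<longrightarrow> v \<le> r)"
proof -
  define I where "I m B \<longleftrightarrow> (\<forall>k. k \<noteq> x \<longrightarrow> k \<noteq> j \<longrightarrow> B k = A k) \<and>
    (B x 0 = n \<and> (\<forall>v<m. \<not> P v) \<or> B x 0 < n \<and> P (B x 0) \<and> (\<forall>v<m. P v \<longrightarrow> v \<le> B x 0))" for m B
  obtain B where "I n B" "sem (Search x j e) A = update B j 0 n"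
    unfolding Search_def sem.simps(3)
  proof (rule for_inv[of I])
    show "I 0 (sem (Put x (Num 0) Size) A)" by (simp add: I_def update_apply)
    fix m B assume m: "m < n" and I: "I m B"
    let ?B = "update B j 0 m"
    have "eval e ?B \<noteq> 0 \<longleftrightarrow> P m"
      by (rule e) (use m I in \<open>auto simp: I_def update_apply\<close>)
    then show "I (Suc m) (sem (Cond e (Put x (Num 0) (Var j)) Skip) ?B)"
      using I xj m by (auto simp: I_def update_apply less_Suc_eq)
  qed
  then show ?thesis using xj by (simp add: I_def update_apply r_def)
qed

text \<open>\<open>Q\<close> is a relation because some tables are specified only up to being zero.
  The premise on the cells from \<open>v\<close> on lets \<open>e\<close> and \<open>c\<close> read
  the old entry of the array being filled, as the recolouring pass does.\<close>

lemma fill: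
  assumes "i \<notin> writes c" "k \<notin> writes c" "i \<noteq> k" "m < n"
    and e: "\<And>B v. v < n \<Longrightarrow> (\<And>l. l \<notin> writes c \<Longrightarrow> l \<noteq> k \<Longrightarrow> l \<noteq> i \<Longrightarrow> B l = A l) \<Longrightarrow> 
      (\<And>l. v \<le> l \<Longrightarrow> B k l = A k l) \<Longrightarrow> B i 0 = v \<Longrightarrow> Q v (eval e (sem c B))"
  shows "Q m (sem (Fill k i c e) A k m)"
proof -
  define I where "I m B \<longleftrightarrow> (\<forall>l. l \<notin> writes c \<longrightarrow> l \<noteq> k \<longrightarrow> l \<noteq> i \<longrightarrow> B l = A l) \<and> (\<forall>v<m. Q v (B k v)) \<and> (\<forall>v\<ge>m. B k v = A k v)" for m B
  obtain B where "I n B" "sem (Fill k i c e) A = update B i 0 n"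
    unfolding Fill_def
  proof (rule for_inv[of I])
    show "I 0 A" by (simp add: I_def)
    fix m B assume m: "m < n" and I: "I m B"
    let ?B = "update B i 0 m"
    have "Q m (eval e (sem c ?B))"
      by (rule e) (use m I assms(3) in \<open>auto simp: I_def update_apply\<close>)
    then show "I (Suc m) (sem (Seq c (Put k (Var i) e)) ?B)"
      using I assms(1-3) by (auto simp: I_def update_apply less_Suc_eq sem_not_writes)
  qed
  then show ?thesis using assms(3,4) by (simp add: I_def update_apply)
qed

end

section \<open>Phases of the decision procedure\<close>

text \<open>Array numbers; a scalar variable is cell 0 of its array.\<close>

abbreviation (input) "ROW \<equiv> 2 :: nat"
abbreviation (input) "ADJ \<equiv> 3 :: nat"
abbreviation (input) "VI \<equiv> 4 :: nat"
abbreviation (input) "VJ \<equiv> 5 :: nat"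
abbreviation (input) "ACC \<equiv> 6 :: nat"
abbreviation (input) "DEG \<equiv> 7 :: nat"
abbreviation (input) "SUPP \<equiv> 8 :: nat"
abbreviation (input) "CORE \<equiv> 9 :: nat"
abbreviation (input) "FORB \<equiv> 10 :: nat"
abbreviation (input) "SEL \<equiv> 11 :: nat"
abbreviation (input) "FST \<equiv> 12 :: nat"
abbreviation (input) "SND \<equiv> 13 :: nat"
abbreviation (input) "REP \<equiv> 14 :: nat"
abbreviation (input) "CDEG \<equiv> 15 :: nat"
abbreviation (input) "PAIRS \<equiv> 16 :: nat"
abbreviation (input) "CROWD \<equiv> 17 :: nat"
abbreviation (input) "COL \<equiv> 18 :: nat"
abbreviation (input) "DONE \<equiv> 19 :: nat"
abbreviation (input) "FAIL \<equiv> 20 :: nat"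
abbreviation (input) "ROUND \<equiv> 21 :: nat"
abbreviation (input) "OPP \<equiv> 22 :: nat"

abbreviation Adj :: "exp \<Rightarrow> exp \<Rightarrow> exp" where
  "Adj a b \<equiv> Arr ADJ (Plus (Arr ROW a) b)"

text \<open>The entry \<open>n * u\<close>, the offset of row \<open>u\<close> in the matrix
  \<open>ADJ\<close>, is obtained as a sum of \<open>n\<close> copies of \<open>u\<close>.\<close>

definition row_prog :: com where
  "row_prog = Fill ROW VI (Count ACC VJ (Var VI)) (Var ACC)"

definition degree_prog :: com where
  "degree_prog = Fill DEG VI (Count ACC VJ (Adj (Var VI) (Var VJ))) (Var ACC)"

definition support_prog :: com where
  "support_prog = Fill SUPP VI
     (Count ACC VJ (Conj (Adj (Var VI) (Var VJ)) (Equal (Arr DEG (Var VJ)) (Num 1)))) (Var ACC)"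

definition core_prog :: com where
  "core_prog = Fill CORE VI Skip
     (Conj (Neg (Equal (Arr DEG (Var VI)) (Num 1))) (Neg (Arr SUPP (Var VI))))"

definition forbidden_prog :: com where
  "forbidden_prog = Fill FORB VI
     (Count ACC VJ (Conj (Adj (Var VI) (Var VJ)) (Arr SUPP (Var VJ)))) (Var ACC)"

text \<open>\<open>Search\<close> keeps the last hit, so this is the largest neighbour, and
  \<open>SND\<close> is the largest other one. For degree 2 the two entries determine the
  neighbourhood, so comparing neighbourhoods takes constant time.\<close>

definition first_prog :: com where
  "first_prog = Fill FST VI (Search SEL VJ (Adj (Var VI) (Var VJ))) (Var SEL)"

definition second_prog :: com where
  "second_prog = Fill SND VI
     (Search SEL VJ (Conj (Adj (Var VI) (Var VJ)) (Neg (Equal (Var VJ) (Arr FST (Var VI)))))) (Var SEL)"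

definition representative_prog :: com where
  "representative_prog = Fill REP VI
     (Count ACC VJ (Conj (Less (Var VJ) (Var VI)) (Conj (Equal (Arr DEG (Var VJ)) (Num 2))
       (Conj (Equal (Arr FST (Var VJ)) (Arr FST (Var VI))) (Equal (Arr SND (Var VJ)) (Arr SND (Var VI)))))))
     (Conj (Equal (Arr DEG (Var VI)) (Num 2)) (Equal (Var ACC) (Num 1)))"

abbreviation Core_adj :: "exp \<Rightarrow> exp \<Rightarrow> exp" where
  "Core_adj a b \<equiv> Conj (Adj a b) (Arr CORE b)"

text \<open>
  With truncated subtraction, summing \<open>d - 1 - j\<close> over \<open>j < n\<close> gives \<open>d choose 2\<close> for \<open>d \<le> n\<close>, without
  a multiplication.
\<close>

definition crowded_prog :: com where
  "crowded_prog = Fill CROWD VI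
     (Seq (Count CDEG VJ (Core_adj (Var VI) (Var VJ)))
     (Seq (Count PAIRS VJ (Minus (Minus (Var CDEG) (Num 1)) (Var VJ)))
          (Count ACC VJ (Conj (Arr REP (Var VJ))
            (Conj (Core_adj (Var VI) (Arr FST (Var VJ))) (Core_adj (Var VI) (Arr SND (Var VJ))))))))
     (Less (Var ACC) (Var PAIRS))"

text \<open>\<open>FORB\<close> holds a count, which the conjunction with 1 normalises. A vertex
  under both constraints gets 3, and \<open>conflict_prog\<close> records that case.\<close>

definition colour_prog :: com where
  "colour_prog = Fill COL VI Skip
     (Plus (Conj (Arr FORB (Var VI)) (Num 1)) (Plus (Arr CROWD (Var VI)) (Arr CROWD (Var VI))))"

definition conflict_prog :: com where
  "conflict_prog = Accumulate FAIL VI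
     (Conj (Arr CORE (Var VI)) (Conj (Arr FORB (Var VI)) (Arr CROWD (Var VI))))"

definition select_prog :: com where
  "select_prog =
     Seq (Search SEL VJ (Conj (Arr CORE (Var VJ)) (Conj (Neg (Arr DONE (Var VJ))) (Arr COL (Var VJ)))))
      (Cond (Less (Var SEL) Size) Skip
        (Seq (Search SEL VJ (Conj (Arr CORE (Var VJ)) (Neg (Arr DONE (Var VJ)))))
          (Cond (Less (Var SEL) Size) (Put COL (Var SEL) (Num 1)) Skip)))"

text \<open>Conflicts are counted before painting; a neighbour painted in this round gets the
  opposite colour and cannot clash with the selected vertex. Vertices outside the core may be
  painted too, but selection and conflict counting look at the core only.\<close>

definition process_prog :: com where
  "process_prog =
     Seq (Put DONE (Var SEL) (Num 1))
     (Seq (Accumulate FAIL VJ (Conj (Core_adj (Var SEL) (Var VJ)) (Equal (Arr COL (Var VJ)) (Arr COL (Var SEL)))))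
     (Seq (Put OPP (Num 0) (Minus (Num 3) (Arr COL (Var SEL))))
       (Fill COL VJ
         (Cond (Conj (Adj (Var SEL) (Var VJ)) (Neg (Arr COL (Var VJ))))
           (Put ACC (Num 0) (Var OPP)) (Put ACC (Num 0) (Arr COL (Var VJ))))
         (Var ACC))))"

definition round_prog :: com where
  "round_prog = Seq select_prog (Cond (Less (Var SEL) Size) process_prog Skip)"

definition decide_prog :: com where
  "decide_prog = Seq degree_prog (Seq support_prog (Seq core_prog (Seq forbidden_prog (Seq first_prog
     (Seq second_prog (Seq representative_prog (Seq crowded_prog (Seq colour_prog (Seq conflict_prog
     (For ROUND round_prog))))))))))"

lemmas phase_defs = row_prog_def degree_prog_def support_prog_def core_prog_def forbidden_prog_def first_prog_def
  second_prog_def representative_prog_def crowded_prog_def colour_prog_def conflict_prog_def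
  select_prog_def process_prog_def round_prog_def

lemma writes_phase [simp]:
  "writes row_prog = {ROW, VI, VJ, ACC}"
  "writes degree_prog = {DEG, VI, VJ, ACC}"
  "writes support_prog = {SUPP, VI, VJ, ACC}"
  "writes core_prog = {CORE, VI}"
  "writes forbidden_prog = {FORB, VI, VJ, ACC}"
  "writes first_prog = {FST, VI, VJ, SEL}"
  "writes second_prog = {SND, VI, VJ, SEL}"
  "writes representative_prog = {REP, VI, VJ, ACC}"
  "writes crowded_prog = {CROWD, VI, VJ, ACC, CDEG, PAIRS}"
  "writes colour_prog = {COL, VI}"
  "writes conflict_prog = {FAIL, VI}"
  "writes round_prog = {SEL, VJ, COL, DONE, FAIL, OPP, ACC}"
  by (auto simp: phase_defs)

lemma wf_decide_prog: "wf_com decide_prog" "wf_com row_prog"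
  by (simp_all add: decide_prog_def phase_defs)

lemma depth_decide_prog: "depth decide_prog = 2" "depth row_prog = 2"
  by (simp_all add: decide_prog_def phase_defs)

section \<open>Correctness of the phases\<close>

locale graph_program = ram n D inp + graph_without_isolated "{..<n}" E
  for n D :: nat and inp :: "nat \<Rightarrow> nat" and E :: "nat set set"
begin

text \<open>Addressed through the table \<open>ROW\<close>, as in the program, so that it survives
  every phase that writes neither \<open>ROW\<close> nor \<open>ADJ\<close>.\<close>

definition encodes :: "store \<Rightarrow> bool" where
  "encodes A \<longleftrightarrow> (\<forall>u<n. \<forall>v<n. A ADJ (A ROW u + v) = of_bool (v \<in> nbh E u))"

lemma card_nbh_bounded: "card {v. v < n \<and> v \<in> nbh E u} = card (nbh E u)"
  using nbh_in_V by (intro arg_cong[where f = card]) auto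

lemma row_correct: "u < n \<Longrightarrow> sem row_prog A ROW u = n * u"
  unfolding row_prog_def
proof (rule fill[where Q = "\<lambda>v x. x = n * v"])
  fix B :: store and v assume "B VI 0 = v"
  then have "sem (Count ACC VJ (Var VI)) B ACC 0 = (\<Sum>w<n. v)"
    by (intro count) auto
  then show "eval (Var ACC) (sem (Count ACC VJ (Var VI)) B) = n * v" by simp
qed auto

lemma degree_correct:
  assumes "encodes A" "u < n"
  shows "sem degree_prog A DEG u = card (nbh E u)"
  unfolding degree_prog_def
proof (rule fill[where Q = "\<lambda>v x. x = card (nbh E v)"])
  fix B v assume v: "v < n" and B: "B VI 0 = v"
    and same: "\<And>l. l \<notin> writes (Count ACC VJ (Adj (Var VI) (Var VJ))) \<Longrightarrow> l \<noteq> DEG \<Longrightarrow> l \<noteq> VI \<Longrightarrow> B l = A l"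
  have "sem (Count ACC VJ (Adj (Var VI) (Var VJ))) B ACC 0 = card {w. w < n \<and> w \<in> nbh E v}"
    by (rule count_card) (use v B same assms in \<open>auto simp: encodes_def\<close>)
  then show "eval (Var ACC) (sem (Count ACC VJ (Adj (Var VI) (Var VJ))) B) = card (nbh E v)"
    by (simp add: card_nbh_bounded)
qed (use assms in auto)

lemma card_pos_iff: "0 < card {v. v < n \<and> P v} \<longleftrightarrow> (\<exists>v<n. P v)"
  by (auto simp: card_gt_0_iff)

lemma support_correct:
  assumes "encodes A" "\<And>u. u < n \<Longrightarrow> A DEG u = card (nbh E u)" "u < n"
  shows "0 < sem support_prog A SUPP u \<longleftrightarrow> support E u"
  unfolding support_prog_def
proof (rule fill[where Q = "\<lambda>v x. 0 < x \<longleftrightarrow> support E v"])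
  let ?e = "Conj (Adj (Var VI) (Var VJ)) (Equal (Arr DEG (Var VJ)) (Num 1))"
  fix B v assume v: "v < n" and B: "B VI 0 = v"
    and same: "\<And>l. l \<notin> writes (Count ACC VJ ?e) \<Longrightarrow> l \<noteq> SUPP \<Longrightarrow> l \<noteq> VI \<Longrightarrow> B l = A l"
  have "sem (Count ACC VJ ?e) B ACC 0 = card {w. w < n \<and> w \<in> nbh E v \<and> leaf E w}"
    by (rule count_card) (use v B same assms in \<open>auto simp: encodes_def leaf_def\<close>)
  then show "0 < eval (Var ACC) (sem (Count ACC VJ ?e) B) \<longleftrightarrow> support E v"
    using nbh_in_V by (auto simp: card_pos_iff support_def)
qed (use assms in auto)

lemma core_correct:
  assumes "\<And>u. u < n \<Longrightarrow> A DEG u = card (nbh E u)" "\<And>u. u < n \<Longrightarrow> 0 < A SUPP u \<longleftrightarrow> support E u" "u < n"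
  shows "sem core_prog A CORE u = of_bool (u \<in> core {..<n} E)"
  unfolding core_prog_def
  by (rule fill[where Q = "\<lambda>v x. x = of_bool (v \<in> core {..<n} E)"])
    (use assms in \<open>auto simp: core_def leaf_def\<close>)

lemma forbidden_correct:
  assumes "encodes A" "\<And>u. u < n \<Longrightarrow> 0 < A SUPP u \<longleftrightarrow> support E u" "u < n"
  shows "0 < sem forbidden_prog A FORB u \<longleftrightarrow> (\<exists>s\<in>nbh E u. support E s)"
  unfolding forbidden_prog_def
proof (rule fill[where Q = "\<lambda>v x. 0 < x \<longleftrightarrow> (\<exists>s\<in>nbh E v. support E s)"])
  let ?e = "Conj (Adj (Var VI) (Var VJ)) (Arr SUPP (Var VJ))"
  fix B v assume v: "v < n" and B: "B VI 0 = v"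
    and same: "\<And>l. l \<notin> writes (Count ACC VJ ?e) \<Longrightarrow> l \<noteq> FORB \<Longrightarrow> l \<noteq> VI \<Longrightarrow> B l = A l"
  have "sem (Count ACC VJ ?e) B ACC 0 = card {w. w < n \<and> w \<in> nbh E v \<and> support E w}"
    by (rule count_card) (use v B same assms in \<open>auto simp: encodes_def\<close>)
  then show "0 < eval (Var ACC) (sem (Count ACC VJ ?e) B) \<longleftrightarrow> (\<exists>s\<in>nbh E v. support E s)"
    using nbh_in_V by (auto simp: card_pos_iff)
qed (use assms in auto)

text \<open>The search succeeds because no vertex is isolated, so \<open>FST\<close> is a genuine
  neighbour for every vertex, whatever its degree.\<close>

lemma first_correct:
  assumes "encodes A" "u < n"
  shows "sem first_prog A FST u \<in> nbh E u \<and> (\<forall>w\<in>nbh E u. w \<le> sem first_prog A FST u)"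
  unfolding first_prog_def
proof (rule fill[where Q = "\<lambda>v x. x \<in> nbh E v \<and> (\<forall>w\<in>nbh E v. w \<le> x)"])
  let ?c = "Search SEL VJ (Adj (Var VI) (Var VJ))"
  fix B v assume v: "v < n" and B: "B VI 0 = v"
    and same: "\<And>l. l \<notin> writes ?c \<Longrightarrow> l \<noteq> FST \<Longrightarrow> l \<noteq> VI \<Longrightarrow> B l = A l"
  let ?r = "sem ?c B SEL 0"
  have r: "?r = n \<and> (\<forall>w<n. w \<notin> nbh E v) \<or> ?r < n \<and> ?r \<in> nbh E v \<and> (\<forall>w<n. w \<in> nbh E v \<longrightarrow> w \<le> ?r)"
    by (rule search) (use v B same assms in \<open>auto simp: encodes_def\<close>)
  have lt: "w < n" if "w \<in> nbh E v" for w
    using nbh_in_V(1)[OF that] by simp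
  have "nbh E v \<noteq> {}" using nbh_nonempty v by simp
  then show "eval (Var SEL) (sem ?c B) \<in> nbh E v \<and> (\<forall>w\<in>nbh E v. w \<le> eval (Var SEL) (sem ?c B))"
    using r lt by auto
qed (use assms in auto)

lemma second_correct:
  assumes "encodes A" "\<And>u. u < n \<Longrightarrow> A FST u \<in> nbh E u" "u < n" "card (nbh E u) = 2"
  shows "nbh E u = {A FST u, sem second_prog A SND u}" "A FST u \<noteq> sem second_prog A SND u"
proof -
  let ?c = "Search SEL VJ (Conj (Adj (Var VI) (Var VJ)) (Neg (Equal (Var VJ) (Arr FST (Var VI)))))"
  have "card (nbh E u) = 2 \<longrightarrow> nbh E u = {A FST u, sem second_prog A SND u} \<and> A FST u \<noteq> sem second_prog A SND u"
    unfolding second_prog_def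
  proof (rule fill[where Q = "\<lambda>v x. card (nbh E v) = 2 \<longrightarrow> nbh E v = {A FST v, x} \<and> A FST v \<noteq> x"])
    fix B v assume v: "v < n" and B: "B VI 0 = v"
      and same: "\<And>l. l \<notin> writes ?c \<Longrightarrow> l \<noteq> SND \<Longrightarrow> l \<noteq> VI \<Longrightarrow> B l = A l"
    have r: "sem ?c B SEL 0 = n \<and> (\<forall>w<n. \<not> (w \<in> nbh E v \<and> w \<noteq> A FST v)) \<or>
      sem ?c B SEL 0 < n \<and> (sem ?c B SEL 0 \<in> nbh E v \<and> sem ?c B SEL 0 \<noteq> A FST v) \<and>
        (\<forall>w<n. w \<in> nbh E v \<and> w \<noteq> A FST v \<longrightarrow> w \<le> sem ?c B SEL 0)"
      by (rule search) (use v B same assms in \<open>auto simp: encodes_def\<close>)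
    show "card (nbh E v) = 2 \<longrightarrow>
      nbh E v = {A FST v, eval (Var SEL) (sem ?c B)} \<and> A FST v \<noteq> eval (Var SEL) (sem ?c B)"
    proof
      assume "card (nbh E v) = 2"
      then obtain a b where ab: "nbh E v = {a, b}" "a \<noteq> b" by (auto simp: card_2_iff)
      have "a < n" "b < n" using nbh_in_V(1)[of _ v] ab by auto
      then show "nbh E v = {A FST v, eval (Var SEL) (sem ?c B)} \<and> A FST v \<noteq> eval (Var SEL) (sem ?c B)"
        using r ab assms(2)[OF v] by auto
    qed
  qed (use assms in auto)
  then show "nbh E u = {A FST u, sem second_prog A SND u}" "A FST u \<noteq> sem second_prog A SND u"
    using assms by auto
qed

definition representative :: "nat \<Rightarrow> bool" where
  "representative w \<longleftrightarrow> card (nbh E w) = 2 \<and> second_of {z\<in>{..<n}. nbh E z = nbh E w} w"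

text \<open>In degree 2, equal neighbourhoods amount to equal \<open>FST\<close> and
  \<open>SND\<close>: the former is a maximum, hence determined by the neighbourhood, and the latter
  is what remains. The loop thus counts the smaller members of the class.\<close>

lemma representative_correct:
  assumes deg: "\<And>u. u < n \<Longrightarrow> A DEG u = card (nbh E u)"
    and fst: "\<And>u. u < n \<Longrightarrow> A FST u \<in> nbh E u \<and> (\<forall>w\<in>nbh E u. w \<le> A FST u)"
    and snd: "\<And>u. u < n \<Longrightarrow> card (nbh E u) = 2 \<Longrightarrow> nbh E u = {A FST u, A SND u} \<and> A FST u \<noteq> A SND u"
    and "u < n"
  shows "sem representative_prog A REP u = of_bool (representative u)"
  unfolding representative_prog_def
proof (rule fill[where Q = "\<lambda>v x. x = of_bool (representative v)"])
  let ?e = "Conj (Less (Var VJ) (Var VI)) (Conj (Equal (Arr DEG (Var VJ)) (Num 2))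
       (Conj (Equal (Arr FST (Var VJ)) (Arr FST (Var VI))) (Equal (Arr SND (Var VJ)) (Arr SND (Var VI)))))"
  fix B v assume v: "v < n" and B: "B VI 0 = v"
    and same: "\<And>l. l \<notin> writes (Count ACC VJ ?e) \<Longrightarrow> l \<noteq> REP \<Longrightarrow> l \<noteq> VI \<Longrightarrow> B l = A l"
  have c: "sem (Count ACC VJ ?e) B ACC 0 =
      card {w. w < n \<and> (w < v \<and> card (nbh E w) = 2 \<and> A FST w = A FST v \<and> A SND w = A SND v)}"
    by (rule count_card) (use v B same deg in auto)
  have eq: "{w. w < n \<and> (w < v \<and> card (nbh E w) = 2 \<and> A FST w = A FST v \<and> A SND w = A SND v)} =
      {z\<in>{z\<in>{..<n}. nbh E z = nbh E v}. z < v}" if two: "card (nbh E v) = 2"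
  proof -
    have "card (nbh E w) = 2 \<and> A FST w = A FST v \<and> A SND w = A SND v \<longleftrightarrow> nbh E w = nbh E v" if w: "w < n" for w
    proof
      assume "card (nbh E w) = 2 \<and> A FST w = A FST v \<and> A SND w = A SND v"
      then show "nbh E w = nbh E v" using snd[OF v two] snd[OF w] by auto
    next
      assume N: "nbh E w = nbh E v"
      then have "A FST w = A FST v" using fst[OF v] fst[OF w] by (auto intro: antisym)
      moreover have "{A FST w, A SND w} = {A FST v, A SND v}" "A FST w \<noteq> A SND w" "A FST v \<noteq> A SND v"
        using snd[OF v two] snd[OF w] N two by auto
      ultimately show "card (nbh E w) = 2 \<and> A FST w = A FST v \<and> A SND w = A SND v"
        using N two by (auto simp: doubleton_eq_iff)
    qed
    then show ?thesis by auto
  qed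
  have "sem (Count ACC VJ ?e) B DEG = B DEG" "sem (Count ACC VJ ?e) B VI = B VI"
    by (simp_all add: sem_not_writes)
  then show "eval (Conj (Equal (Arr DEG (Var VI)) (Num 2)) (Equal (Var ACC) (Num 1))) (sem (Count ACC VJ ?e) B)
      = of_bool (representative v)"
    using c eq B v same deg by (auto simp: representative_def second_of_def)
qed (use assms in auto)

text \<open>Only terms with \<open>j < d\<close> survive truncation; read backwards, they are 0,
  ..., \<open>d - 1\<close>.\<close>

lemma sum_diff_choose_two: "d \<le> m \<Longrightarrow> (\<Sum>j<m. d - 1 - j) = d choose 2"
proof -
  assume d: "d \<le> m"
  have "(\<Sum>j<m. d - 1 - j) = (\<Sum>j<d. d - Suc j)"
    by (rule sum.mono_neutral_cong_right) (use d in auto)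
  also have "\<dots> = (\<Sum>j<d. j)" by (rule sum.nat_diff_reindex)
  also have "\<dots> = d choose 2" by (induction d) (auto simp: numeral_2_eq_2)
  finally show ?thesis .
qed

lemma crowded_correct:
  assumes enc: "encodes A"
    and core: "\<And>u. u < n \<Longrightarrow> A CORE u = of_bool (u \<in> core {..<n} E)"
    and fst: "\<And>u. u < n \<Longrightarrow> A FST u \<in> nbh E u"
    and snd: "\<And>u. u < n \<Longrightarrow> card (nbh E u) = 2 \<Longrightarrow> nbh E u = {A FST u, A SND u}"
    and rep: "\<And>u. u < n \<Longrightarrow> A REP u = of_bool (representative u)"
    and "u < n"
  shows "sem crowded_prog A CROWD u = of_bool (crowded {..<n} E u)"
  unfolding crowded_prog_def
proof (rule fill[where Q = "\<lambda>v x. x = of_bool (crowded {..<n} E v)"])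
  let ?c1 = "Count CDEG VJ (Core_adj (Var VI) (Var VJ))"
  let ?c2 = "Count PAIRS VJ (Minus (Minus (Var CDEG) (Num 1)) (Var VJ))"
  let ?c3 = "Count ACC VJ (Conj (Arr REP (Var VJ))
            (Conj (Core_adj (Var VI) (Arr FST (Var VJ))) (Core_adj (Var VI) (Arr SND (Var VJ)))))"
  fix B v assume v: "v < n" and B: "B VI 0 = v"
    and same: "\<And>l. l \<notin> writes (Seq ?c1 (Seq ?c2 ?c3)) \<Longrightarrow> l \<noteq> CROWD \<Longrightarrow> l \<noteq> VI \<Longrightarrow> B l = A l"
  define N where "N = nbh E v \<inter> core {..<n} E"
  have N_lt: "w < n" if "w \<in> nbh E x" for w x using nbh_in_V(1)[OF that] by simp
  define B1 where "B1 = sem ?c1 B"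
  define B2 where "B2 = sem ?c2 B1"
  define B3 where "B3 = sem ?c3 B2"
  have B1: "B1 l = B l" if "l \<notin> {CDEG, VJ}" for l
    using that unfolding B1_def by (intro sem_not_writes) simp
  have B2: "B2 l = B1 l" if "l \<notin> {PAIRS, VJ}" for l
    using that unfolding B2_def by (intro sem_not_writes) simp
  have B3: "B3 l = B2 l" if "l \<notin> {ACC, VJ}" for l
    using that unfolding B3_def by (intro sem_not_writes) simp
  have "B1 CDEG 0 = card {w. w < n \<and> (w \<in> nbh E v \<and> w \<in> core {..<n} E)}"
    unfolding B1_def by (rule count_card) (use v B same enc core in \<open>auto simp: encodes_def\<close>)
  also have "{w. w < n \<and> (w \<in> nbh E v \<and> w \<in> core {..<n} E)} = N" using N_lt by (auto simp: N_def)
  finally have cd: "B1 CDEG 0 = card N" .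
  have "B2 PAIRS 0 = (\<Sum>j<n. card N - 1 - j)"
    unfolding B2_def by (rule count) (use cd in auto)
  also have "card N \<le> card {..<n}" using N_lt by (intro card_mono) (auto simp: N_def)
  then have "(\<Sum>j<n. card N - 1 - j) = card N choose 2" by (intro sum_diff_choose_two) simp
  finally have pairs: "B3 PAIRS 0 = card N choose 2" using B3 by simp
  have "B3 ACC 0 = card {w. w < n \<and> (representative w \<and> nbh E w \<subseteq> N)}"
    unfolding B3_def
  proof (rule count_card)
    fix C w assume w: "w < n" and C: "C VJ 0 = w" and sameC: "\<And>k. k \<noteq> ACC \<Longrightarrow> k \<noteq> VJ \<Longrightarrow> C k = B2 k"
    have CA: "C l = A l" if "l \<in> {ROW, ADJ, CORE, FST, SND, REP}" for l
      using that sameC B1 B2 same by auto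
    have CI: "C VI 0 = v" using sameC B1 B2 B by simp
    show "eval (Conj (Arr REP (Var VJ)) (Conj (Core_adj (Var VI) (Arr FST (Var VJ))) (Core_adj (Var VI) (Arr SND (Var VJ))))) C
      = of_bool (representative w \<and> nbh E w \<subseteq> N)"
    proof (cases "representative w")
      case True
      then have "nbh E w = {A FST w, A SND w}" using snd[OF w] by (simp add: representative_def)
      moreover from this have "A FST w < n" "A SND w < n" using N_lt[of _ w] by auto
      ultimately show ?thesis
        using True w v enc core rep C CI CA by (auto simp: encodes_def N_def)
    next
      \<comment> \<open>\<open>Conj\<close> evaluates all its parts. For other vertices
        \<open>SND\<close> may be \<open>n\<close> and the lookups meaningless, but the zero in
        \<open>REP\<close> decides.\<close>
      case False
      then show ?thesis using rep[OF w] C CA by simp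
    qed
  qed simp
  also have "{w. w < n \<and> (representative w \<and> nbh E w \<subseteq> N)} =
      {w\<in>{..<n}. nbh E w \<subseteq> N \<and> card (nbh E w) = 2 \<and> second_of {z\<in>{..<n}. nbh E z = nbh E w} w}"
    by (auto simp: representative_def)
  finally have "B3 ACC 0 < B3 PAIRS 0 \<longleftrightarrow> crowded {..<n} E v"
    unfolding pairs crowded_iff_count N_def by simp
  then show "eval (Less (Var ACC) (Var PAIRS)) (sem (Seq ?c1 (Seq ?c2 ?c3)) B) = of_bool (crowded {..<n} E v)"
    by (simp add: B1_def B2_def B3_def)
qed (use assms in auto)

lemma colour_correct:
  assumes "\<And>u. u < n \<Longrightarrow> A CROWD u = of_bool (Q u)" "\<And>u. u < n \<Longrightarrow> 0 < A FORB u \<longleftrightarrow> P u" "u < n"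
  shows "sem colour_prog A COL u = of_bool (P u) + 2 * of_bool (Q u)"
  unfolding colour_prog_def
  by (rule fill[where Q = "\<lambda>v x. x = of_bool (P v) + 2 * of_bool (Q v)"]) (use assms in auto)

lemma conflict_correct:
  assumes "\<And>u. u < n \<Longrightarrow> A CROWD u = of_bool (Q u)" "\<And>u. u < n \<Longrightarrow> 0 < A FORB u \<longleftrightarrow> P u"
    and "\<And>u. u < n \<Longrightarrow> A CORE u = of_bool (u \<in> core {..<n} E)" and "A FAIL 0 = 0"
  shows "sem conflict_prog A FAIL 0 = 0 \<longleftrightarrow> (\<forall>v\<in>core {..<n} E. \<not> (P v \<and> Q v))"
proof -
  have "sem conflict_prog A FAIL 0 = A FAIL 0 + (\<Sum>v<n. of_bool (v \<in> core {..<n} E \<and> P v \<and> Q v))"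
    unfolding conflict_prog_def by (rule accumulate) (use assms in auto)
  then show ?thesis using assms by (auto simp: core_def)
qed

section \<open>Correctness of the colouring rounds\<close>

lemma select_correct:
  assumes core: "\<And>u. u < n \<Longrightarrow> A CORE u = of_bool (u \<in> core {..<n} E)"
  defines "B \<equiv> sem select_prog A"
  shows "B SEL 0 = n \<and> (\<forall>v\<in>core {..<n} E. A DONE v \<noteq> 0) \<and> B COL = A COL \<or>
    B SEL 0 \<in> core {..<n} E \<and> A DONE (B SEL 0) = 0 \<and>
      (A COL (B SEL 0) \<noteq> 0 \<and> B COL = A COL \<or>
       (\<forall>v\<in>core {..<n} E. A DONE v = 0 \<longrightarrow> A COL v = 0) \<and> B COL = (A COL)(B SEL 0 := 1))"
proof -
  let ?s1 = "Search SEL VJ (Conj (Arr CORE (Var VJ)) (Conj (Neg (Arr DONE (Var VJ))) (Arr COL (Var VJ))))"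
  let ?s2 = "Search SEL VJ (Conj (Arr CORE (Var VJ)) (Neg (Arr DONE (Var VJ))))"
  have core_lt: "v < n" if "v \<in> core {..<n} E" for v using that by (simp add: core_def)
  define B1 where "B1 = sem ?s1 A"
  define B2 where "B2 = sem ?s2 B1"
  have B1: "B1 l = A l" if "l \<notin> {SEL, VJ}" for l
    using that unfolding B1_def by (intro sem_not_writes) simp
  have B2: "B2 l = A l" if "l \<notin> {SEL, VJ}" for l
    using that B1 unfolding B2_def by (subst sem_not_writes) simp_all
  have 1: "B1 SEL 0 = n \<and> (\<forall>v<n. \<not> (v \<in> core {..<n} E \<and> A DONE v = 0 \<and> A COL v \<noteq> 0)) \<or>
    B1 SEL 0 < n \<and> (B1 SEL 0 \<in> core {..<n} E \<and> A DONE (B1 SEL 0) = 0 \<and> A COL (B1 SEL 0) \<noteq> 0) \<and>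
      (\<forall>v<n. v \<in> core {..<n} E \<and> A DONE v = 0 \<and> A COL v \<noteq> 0 \<longrightarrow> v \<le> B1 SEL 0)"
    unfolding B1_def by (rule search) (use core in auto)
  have 2: "B2 SEL 0 = n \<and> (\<forall>v<n. \<not> (v \<in> core {..<n} E \<and> A DONE v = 0)) \<or>
    B2 SEL 0 < n \<and> (B2 SEL 0 \<in> core {..<n} E \<and> A DONE (B2 SEL 0) = 0) \<and>
      (\<forall>v<n. v \<in> core {..<n} E \<and> A DONE v = 0 \<longrightarrow> v \<le> B2 SEL 0)"
    unfolding B2_def by (rule search) (use core B1 in auto)
  show ?thesis
  proof (cases "B1 SEL 0 < n")
    case True
    then have "B = B1" by (simp add: B_def select_prog_def B1_def)
    then show ?thesis using 1 B1 True by auto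
  next
    case False
    then have "\<forall>v<n. \<not> (v \<in> core {..<n} E \<and> A DONE v = 0 \<and> A COL v \<noteq> 0)" using 1 by blast
    then have none: "\<forall>v\<in>core {..<n} E. A DONE v = 0 \<longrightarrow> A COL v = 0" using core_lt by blast
    have B: "B = (if B2 SEL 0 < n then update B2 COL (B2 SEL 0) 1 else B2)"
      using False by (simp add: B_def select_prog_def B1_def B2_def)
    show ?thesis
    proof (cases "B2 SEL 0 < n")
      case True
      then show ?thesis using 2 none B B2[of COL] by (auto simp: update_apply)
    next
      case False
      then show ?thesis using 2 B B2[of COL] core_lt by auto
    qed
  qed
qed

lemma process_correct:
  assumes enc: "encodes A" and core: "\<And>u. u < n \<Longrightarrow> A CORE u = of_bool (u \<in> core {..<n} E)"
    and s: "A SEL 0 < n"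
  defines "B \<equiv> sem process_prog A" and "s \<equiv> A SEL 0"
  shows "B DONE = (A DONE)(s := 1)"
    and "B FAIL 0 = 0 \<longleftrightarrow> A FAIL 0 = 0 \<and> (\<forall>v\<in>nbh E s \<inter> core {..<n} E. A COL v \<noteq> A COL s)"
    and "v < n \<Longrightarrow> B COL v = (if v \<in> nbh E s \<and> A COL v = 0 then 3 - A COL s else A COL v)"
proof -
  let ?f = "Accumulate FAIL VJ (Conj (Core_adj (Var SEL) (Var VJ)) (Equal (Arr COL (Var VJ)) (Arr COL (Var SEL))))"
  let ?p = "Cond (Conj (Adj (Var SEL) (Var VJ)) (Neg (Arr COL (Var VJ))))
           (Put ACC (Num 0) (Var OPP)) (Put ACC (Num 0) (Arr COL (Var VJ)))"
  define B1 where "B1 = update A DONE s 1"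
  define B2 where "B2 = sem ?f B1"
  define B3 where "B3 = update B2 OPP 0 (3 - B2 COL (B2 SEL 0))"
  have B: "B = sem (Fill COL VJ ?p (Var ACC)) B3"
    by (simp add: B_def process_prog_def B1_def B2_def B3_def s_def)
  have B2: "B2 l = B1 l" if "l \<notin> {FAIL, VJ}" for l
    using that unfolding B2_def by (intro sem_not_writes) simp
  have BB3: "B l = B3 l" if "l \<notin> {COL, VJ, ACC}" for l
    using that unfolding B by (intro sem_not_writes) auto
  show "B DONE = (A DONE)(s := 1)"
    using BB3[of DONE] B2[of DONE] by (simp add: B3_def B1_def update_apply)
  have "B2 FAIL 0 = B1 FAIL 0 + (\<Sum>v<n. of_bool (v \<in> nbh E s \<and> v \<in> core {..<n} E \<and> A COL v = A COL s))"
    unfolding B2_def by (rule accumulate) (use enc core s in \<open>auto simp: B1_def update_apply encodes_def s_def\<close>)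
  moreover have "B FAIL 0 = B2 FAIL 0" "B1 FAIL 0 = A FAIL 0"
    using BB3[of FAIL] by (auto simp: B3_def B1_def update_apply)
  ultimately show "B FAIL 0 = 0 \<longleftrightarrow> A FAIL 0 = 0 \<and> (\<forall>v\<in>nbh E s \<inter> core {..<n} E. A COL v \<noteq> A COL s)"
    by (auto simp: core_def)
  assume v: "v < n"
  show "B COL v = (if v \<in> nbh E s \<and> A COL v = 0 then 3 - A COL s else A COL v)"
    unfolding B
  proof (rule fill[where Q = "\<lambda>v x. x = (if v \<in> nbh E s \<and> A COL v = 0 then 3 - A COL s else A COL v)"])
    \<comment> \<open>The pass overwrites the array it reads: cell \<open>v\<close> still has its
      old value when its turn comes, and the colour to paint was saved in \<open>OPP\<close>
      beforehand.\<close>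
    fix C v assume v: "v < n" and C: "C VJ 0 = v" "\<And>l. v \<le> l \<Longrightarrow> C COL l = B3 COL l"
      and same: "\<And>l. l \<notin> writes ?p \<Longrightarrow> l \<noteq> COL \<Longrightarrow> l \<noteq> VJ \<Longrightarrow> C l = B3 l"
    have "C ROW = A ROW" "C ADJ = A ADJ" "C SEL 0 = s" "C OPP 0 = 3 - A COL s" "C COL v = A COL v"
      using same[of ROW] same[of ADJ] same[of SEL] same[of OPP] C(2)[of v] B2
      by (auto simp: B3_def B1_def update_apply s_def)
    then show "eval (Var ACC) (sem ?p C) = (if v \<in> nbh E s \<and> A COL v = 0 then 3 - A COL s else A COL v)"
      using enc v s C(1) by (auto simp: update_apply encodes_def s_def)
  qed (use v in auto)
qed

lemma round_correct:
  assumes "encodes A" "\<And>u. u < n \<Longrightarrow> A CORE u = of_bool (u \<in> core {..<n} E)"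
  defines "B \<equiv> sem round_prog A"
  shows "advance (core {..<n} E) (nbh E) (A COL, A DONE, A FAIL 0) (B COL, B DONE, B FAIL 0)"
proof -
  define S where "S = sem select_prog A"
  define s where "s = S SEL 0"
  have keep: "S l = A l" if "l \<notin> {SEL, VJ, COL}" for l
    using that unfolding S_def by (intro sem_not_writes) (simp add: select_prog_def)
  have core_lt: "v < n" if "v \<in> core {..<n} E" for v using that by (simp add: core_def)
  have "s = n \<and> (\<forall>v\<in>core {..<n} E. A DONE v \<noteq> 0) \<and> S COL = A COL \<or>
    s \<in> core {..<n} E \<and> A DONE s = 0 \<and>
      (A COL s \<noteq> 0 \<and> S COL = A COL \<or>
       (\<forall>v\<in>core {..<n} E. A DONE v = 0 \<longrightarrow> A COL v = 0) \<and> S COL = (A COL)(s := 1))"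
    unfolding S_def s_def by (rule select_correct[of A]) (rule assms(2))
  then consider
      "s = n" "\<forall>v\<in>core {..<n} E. A DONE v \<noteq> 0" "S COL = A COL"
    | "s \<in> core {..<n} E" "A DONE s = 0" "A COL s \<noteq> 0 \<and> S COL = A COL \<or>
       (\<forall>v\<in>core {..<n} E. A DONE v = 0 \<longrightarrow> A COL v = 0) \<and> S COL = (A COL)(s := 1)"
    by metis
  then show ?thesis
  proof cases
    case 1
    then have "B = S" by (simp add: B_def round_prog_def S_def s_def)
    then show ?thesis using 1 keep by (simp add: advance_def)
  next
    case 2
    then have lt: "S SEL 0 < n" using core_lt s_def by simp
    have B: "B = sem process_prog S" using lt by (simp add: B_def round_prog_def S_def)
    have "encodes S" "\<And>u. u < n \<Longrightarrow> S CORE u = of_bool (u \<in> core {..<n} E)"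
      using assms keep by (simp_all add: encodes_def)
    note P = process_correct[OF this lt, folded B s_def]
    have d: "B DONE = (A DONE)(s := 1)" using P(1) keep by simp
    have f: "B FAIL 0 = 0 \<longleftrightarrow> A FAIL 0 = 0 \<and> (\<forall>v\<in>nbh E s \<inter> core {..<n} E. S COL v \<noteq> S COL s)"
      using P(2) keep by simp
    have c: "\<forall>v\<in>core {..<n} E. B COL v = (if v \<in> nbh E s \<and> S COL v = 0 then 3 - S COL s else S COL v)"
      using P(3) core_lt by blast
    \<comment> \<open>The intermediate colouring in \<open>advance\<close> is the one after
      selection, \<open>S COL\<close>, where a freshly chosen \<open>s\<close> already has colour
      1.\<close>
    show ?thesis
      unfolding advance_def prod.case
      by (intro disjI2 bexI[of _ s] exI[of _ "S COL"] conjI 2 d f c)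
  qed
qed

lemma colouring_correct:
  assumes enc: "encodes A" and core: "\<And>u. u < n \<Longrightarrow> A CORE u = of_bool (u \<in> core {..<n} E)"
    and col: "\<And>u. u < n \<Longrightarrow> A COL u = of_bool (P u) + 2 * of_bool (Q u)"
    and don: "\<And>u. u < n \<Longrightarrow> A DONE u = 0"
    and fail: "A FAIL 0 = 0 \<longleftrightarrow> (\<forall>v\<in>core {..<n} E. \<not> (P v \<and> Q v))"
  shows "sem (For ROUND round_prog) A FAIL 0 = 0 \<longleftrightarrow> (\<exists>f. proper (core {..<n} E) (nbh E) P Q f)"
proof -
  define B where "B m = fold (\<lambda>j A. sem round_prog (update A ROUND 0 j)) [0..<m] A" for m
  define tr where "tr C = (C COL, C DONE, C FAIL 0)" for C :: store
  have B_Suc: "B (Suc m) = sem round_prog (update (B m) ROUND 0 m)" for m by (simp add: B_def)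
  have keep: "B m l = A l" if "l \<in> {ROW, ADJ, CORE}" for m l
  proof (induction m)
    case 0 then show ?case by (simp add: B_def)
  next
    case (Suc m)
    have "sem round_prog C l = C l" for C using that by (intro sem_not_writes) auto
    then show ?case using Suc that by (auto simp: B_Suc update_apply)
  qed
  interpret colouring "core {..<n} E" "nbh E" P Q
    by unfold_locales (use nbh_sym nbh_irrefl in \<open>auto simp: core_def\<close>)
  have core_lt: "v < n" if "v \<in> core {..<n} E" for v using that by (simp add: core_def)
  have "snd (snd (tr (B n))) = 0 \<longleftrightarrow> (\<exists>f. proper (core {..<n} E) (nbh E) P Q f)"
  proof (rule rounds_decide[where s = "\<lambda>m. tr (B m)"])
    fix m
    have "encodes (update (B m) ROUND 0 m)" using enc keep by (simp add: encodes_def update_apply)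
    moreover have "update (B m) ROUND 0 m CORE u = of_bool (u \<in> core {..<n} E)" if "u < n" for u
      using core[OF that] keep by (simp add: update_apply)
    ultimately show "advance (core {..<n} E) (nbh E) (tr (B m)) (tr (B (Suc m)))"
      using round_correct[of "update (B m) ROUND 0 m"] by (simp add: tr_def B_Suc update_apply)
  next
    have "card (core {..<n} E) \<le> card {..<n}" by (intro card_mono) (auto simp: core_def)
    then show "card (core {..<n} E) \<le> n" by simp
  qed (use col don fail core_lt in \<open>auto simp: tr_def B_def\<close>)
  then show ?thesis by (simp add: tr_def B_def update_apply)
qed

text \<open>Each table is carried unchanged from the phase that computes it to those that read it.
  \<open>DONE\<close> and \<open>FAIL\<close> are not initialised by the program, so they must start
  out as zero.\<close>

lemma decide_correct:
  assumes enc: "encodes A" and don: "A DONE = (\<lambda>_. 0)" and fail: "A FAIL 0 = 0"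
  shows "sem decide_prog A FAIL 0 = 0 \<longleftrightarrow> domination_number {..<n} E = covering_number {..<n} E"
proof -
  define P where "P v \<longleftrightarrow> (\<exists>s\<in>nbh E v. support E s)" for v
  define A1 where "A1 = sem degree_prog A"
  define A2 where "A2 = sem support_prog A1"
  define A3 where "A3 = sem core_prog A2"
  define A4 where "A4 = sem forbidden_prog A3"
  define A5 where "A5 = sem first_prog A4"
  define A6 where "A6 = sem second_prog A5"
  define A7 where "A7 = sem representative_prog A6"
  define A8 where "A8 = sem crowded_prog A7"
  define A9 where "A9 = sem colour_prog A8"
  define A10 where "A10 = sem conflict_prog A9"
  have k1: "A1 l = A l" if "l \<notin> writes degree_prog" for l unfolding A1_def by (rule sem_not_writes[OF that])
  have k2: "A2 l = A1 l" if "l \<notin> writes support_prog" for l unfolding A2_def by (rule sem_not_writes[OF that])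
  have k3: "A3 l = A2 l" if "l \<notin> writes core_prog" for l unfolding A3_def by (rule sem_not_writes[OF that])
  have k4: "A4 l = A3 l" if "l \<notin> writes forbidden_prog" for l unfolding A4_def by (rule sem_not_writes[OF that])
  have k5: "A5 l = A4 l" if "l \<notin> writes first_prog" for l unfolding A5_def by (rule sem_not_writes[OF that])
  have k6: "A6 l = A5 l" if "l \<notin> writes second_prog" for l unfolding A6_def by (rule sem_not_writes[OF that])
  have k7: "A7 l = A6 l" if "l \<notin> writes representative_prog" for l unfolding A7_def by (rule sem_not_writes[OF that])
  have k8: "A8 l = A7 l" if "l \<notin> writes crowded_prog" for l unfolding A8_def by (rule sem_not_writes[OF that])
  have k9: "A9 l = A8 l" if "l \<notin> writes colour_prog" for l unfolding A9_def by (rule sem_not_writes[OF that])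
  have k10: "A10 l = A9 l" if "l \<notin> writes conflict_prog" for l unfolding A10_def by (rule sem_not_writes[OF that])
  note keep = k1 k2 k3 k4 k5 k6 k7 k8 k9 k10
  have e: "encodes A1" "encodes A2" "encodes A3" "encodes A4" "encodes A5" "encodes A6" "encodes A7"
    "encodes A8" "encodes A9" "encodes A10"
    using enc by (simp_all add: encodes_def keep)
  have deg: "A1 DEG u = card (nbh E u)" if "u < n" for u
    unfolding A1_def by (rule degree_correct[OF enc that])
  have sup: "0 < A2 SUPP u \<longleftrightarrow> support E u" if "u < n" for u
    unfolding A2_def by (rule support_correct[where A = A1, OF e(1) deg that])
  have core: "A3 CORE u = of_bool (u \<in> core {..<n} E)" if "u < n" for u
    unfolding A3_def by (rule core_correct[where A = A2, OF _ sup that]) (simp add: deg keep)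
  have forb: "0 < A4 FORB u \<longleftrightarrow> P u" if "u < n" for u
    unfolding A4_def P_def by (rule forbidden_correct[OF e(3) _ that]) (simp add: sup keep)
  have fst: "A5 FST u \<in> nbh E u \<and> (\<forall>w\<in>nbh E u. w \<le> A5 FST u)" if "u < n" for u
    unfolding A5_def by (rule first_correct[OF e(4) that])
  have snd: "nbh E u = {A6 FST u, A6 SND u} \<and> A6 FST u \<noteq> A6 SND u" if "u < n" "card (nbh E u) = 2" for u
    using second_correct[where A = A5, OF e(5) _ that] fst keep(6)[of FST] by (simp add: A6_def)
  have rep: "A7 REP u = of_bool (representative u)" if "u < n" for u
    unfolding A7_def by (rule representative_correct[where A = A6, OF _ _ snd that]) (simp_all add: deg fst keep)
  have crowd: "A8 CROWD u = of_bool (crowded {..<n} E u)" if "u < n" for u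
    unfolding A8_def
  proof (rule crowded_correct[where A = A7, OF e(7) _ _ _ rep that])
    show "nbh E u = {A7 FST u, A7 SND u}" if "u < n" "card (nbh E u) = 2" for u
      using snd[OF that] keep(7)[of FST] keep(7)[of SND] by simp
  qed (simp_all add: core fst keep)
  have col: "A9 COL u = of_bool (P u) + 2 * of_bool (crowded {..<n} E u)" if "u < n" for u
    unfolding A9_def by (rule colour_correct[where A = A8, OF crowd _ that]) (simp_all add: forb keep)
  have fail10: "A10 FAIL 0 = 0 \<longleftrightarrow> (\<forall>v\<in>core {..<n} E. \<not> (P v \<and> crowded {..<n} E v))"
    unfolding A10_def by (rule conflict_correct) (simp_all add: crowd forb core fail keep)
  have "sem (For ROUND round_prog) A10 FAIL 0 = 0 \<longleftrightarrow> (\<exists>f. proper (core {..<n} E) (nbh E) P (crowded {..<n} E) f)"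
    by (rule colouring_correct[OF e(10)]) (simp_all add: core col don fail10 keep)
  also have "\<dots> \<longleftrightarrow> (\<exists>f. admissible {..<n} E f)"
    by (simp add: proper_def admissible_def P_def)
  finally show ?thesis
    by (simp only: equal_iff_admissible decide_prog_def sem.simps(3)
        A1_def A2_def A3_def A4_def A5_def A6_def A7_def A8_def A9_def A10_def)
qed

end

section \<open>Reading the two input formats\<close>

definition matrix_prog :: com where
  "matrix_prog = For VI (For VJ (Put ADJ (Plus (Arr ROW (Var VI)) (Var VJ))
     (Inp (Plus (Arr ROW (Var VI)) (Var VJ)))))"

text \<open>The inner loop always runs to \<open>n\<close> and tests whether the position still lies
  before the start of the next list. Short lists waste rounds, but the cost stays quadratic.\<close>

definition lists_prog :: com where
  "lists_prog = For VI (For VJ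
     (Cond (Less (Plus (Inp (Var VI)) (Var VJ)) (Inp (Plus (Var VI) (Num 1))))
       (Put ADJ (Plus (Arr ROW (Var VI)) (Inp (Plus (Inp (Var VI)) (Var VJ)))) (Num 1)) Skip))"

lemma input_prog_simps [simp]:
  "wf_com matrix_prog" "wf_com lists_prog" "depth matrix_prog = 2" "depth lists_prog = 2"
  "writes matrix_prog = {ADJ, VI, VJ}" "writes lists_prog = {ADJ, VI, VJ}"
  by (auto simp: matrix_prog_def lists_prog_def)

lemma (in ram) layout_input: "a < D \<Longrightarrow> layout A a = inp a"
  by (simp add: layout_def)

lemma row_major_less: "(u::nat) < n \<Longrightarrow> v < n \<Longrightarrow> n * u + v < n * n"
proof -
  assume "u < n" "v < n"
  then have "n * u + v < n * Suc u" by simp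
  also have "\<dots> \<le> n * n" using \<open>u < n\<close> by (intro mult_le_mono2) simp
  finally show ?thesis .
qed

lemma row_major_eq: "(v::nat) < n \<Longrightarrow> v' < n \<Longrightarrow> n * u + v = n * u' + v' \<longleftrightarrow> u = u' \<and> v = v'"
proof
  assume v: "v < n" "v' < n" and eq: "n * u + v = n * u' + v'"
  have "(n * u + v) div n = u" "(n * u' + v') div n = u'" using v by auto
  then show "u = u' \<and> v = v'" using eq by auto
qed auto

text \<open>Both readers produce the same matrix in \<open>ADJ\<close>, so one decision procedure
  serves both formats. \<open>row_prog\<close> comes before them because they already address
  \<open>ADJ\<close> through \<open>ROW\<close>.\<close>

definition full_prog :: "com \<Rightarrow> com" where
  "full_prog c = Seq row_prog (Seq c decide_prog)"

context graph_program
begin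

lemma matrix_correct:
  assumes row: "\<And>u. u < n \<Longrightarrow> A ROW u = n * u" and D: "n * n \<le> D"
    and inp: "\<And>u v. u < n \<Longrightarrow> v < n \<Longrightarrow> inp (n * u + v) = of_bool (v \<in> nbh E u)"
  shows "encodes (sem matrix_prog A)"
proof -
  define I1 where "I1 m B \<longleftrightarrow> B ROW = A ROW \<and>
    (\<forall>u<m. \<forall>v<n. B ADJ (n * u + v) = inp (n * u + v))" for m and B :: store
  define I2 where "I2 m l B \<longleftrightarrow> I1 m B \<and> B VI 0 = m \<and> (\<forall>v<l. B ADJ (n * m + v) = inp (n * m + v))"
    for m l and B :: store
  obtain B where B: "I1 n B" "sem matrix_prog A = update B VI 0 n"
    unfolding matrix_prog_def
  proof (rule for_inv[of I1])
    show "I1 0 A" by (simp add: I1_def)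
    fix m B assume m: "m < n" and I1: "I1 m B"
    obtain C where C: "I2 m n C" "sem (For VJ (Put ADJ (Plus (Arr ROW (Var VI)) (Var VJ))
     (Inp (Plus (Arr ROW (Var VI)) (Var VJ))))) (update B VI 0 m) = update C VJ 0 n"
    proof (rule for_inv[of "I2 m"])
      show "I2 m 0 (update B VI 0 m)" using I1 by (simp add: I1_def I2_def update_apply)
      fix l C assume l: "l < n" and I2: "I2 m l C"
      have "n * m + l < D" using row_major_less[OF m l] D by simp
      then show "I2 m (Suc l) (sem (Put ADJ (Plus (Arr ROW (Var VI)) (Var VJ))
          (Inp (Plus (Arr ROW (Var VI)) (Var VJ)))) (update C VJ 0 l))"
        using I2 row[OF m] by (auto simp: I1_def I2_def update_apply layout_input less_Suc_eq)
    qed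
    then show "I1 (Suc m) (sem (For VJ (Put ADJ (Plus (Arr ROW (Var VI)) (Var VJ))
     (Inp (Plus (Arr ROW (Var VI)) (Var VJ))))) (update B VI 0 m))"
      unfolding C(2) by (auto simp: I1_def I2_def update_apply less_Suc_eq)
  qed
  then show ?thesis using row inp by (auto simp: I1_def encodes_def update_apply)
qed

text \<open>This reader writes only ones, so it relies on \<open>ADJ\<close> being zero.
  \<open>I2 m l\<close> says that the first \<open>l\<close> entries of list \<open>m\<close> have
  been entered.\<close>

lemma lists_correct:
  assumes row: "\<And>u. u < n \<Longrightarrow> A ROW u = n * u" and zero: "A ADJ = (\<lambda>_. 0)" and D: "n < D"
    and ls: "\<And>u. u < n \<Longrightarrow> set (ls u) = nbh E u" "\<And>u. u < n \<Longrightarrow> length (ls u) \<le> n"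
    and inp: "\<And>u. u < n \<Longrightarrow> inp (Suc u) = inp u + length (ls u)"
      "\<And>u j. u < n \<Longrightarrow> j < length (ls u) \<Longrightarrow> inp u + j < D \<and> inp (inp u + j) = ls u ! j"
  shows "encodes (sem lists_prog A)"
proof -
  define I1 where "I1 m B \<longleftrightarrow> B ROW = A ROW \<and>
    (\<forall>u<n. \<forall>v<n. B ADJ (n * u + v) = of_bool (u < m \<and> v \<in> nbh E u))" for m and B :: store
  define I2 where "I2 m l B \<longleftrightarrow> B ROW = A ROW \<and> B VI 0 = m \<and>
    (\<forall>u<n. \<forall>v<n. B ADJ (n * u + v) = of_bool (u < m \<and> v \<in> nbh E u \<or> u = m \<and> v \<in> set (take l (ls m))))"
    for m l and B :: store
  let ?c = "Cond (Less (Plus (Inp (Var VI)) (Var VJ)) (Inp (Plus (Var VI) (Num 1))))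
       (Put ADJ (Plus (Arr ROW (Var VI)) (Inp (Plus (Inp (Var VI)) (Var VJ)))) (Num 1)) Skip"
  obtain B where B: "I1 n B" "sem lists_prog A = update B VI 0 n"
    unfolding lists_prog_def
  proof (rule for_inv[of I1])
    show "I1 0 A" using zero by (simp add: I1_def)
    fix m B assume m: "m < n" and I1: "I1 m B"
    obtain C where C: "I2 m n C" "sem (For VJ ?c) (update B VI 0 m) = update C VJ 0 n"
    proof (rule for_inv[of "I2 m"])
      show "I2 m 0 (update B VI 0 m)" using I1 by (simp add: I1_def I2_def update_apply)
      fix l C assume l: "l < n" and I2: "I2 m l C"
      let ?C = "update C VJ 0 l"
      have vars: "?C VI 0 = m" "?C VJ 0 = l" "?C ROW m = n * m"
        using I2 row[OF m] by (auto simp: I2_def update_apply)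
      have addr: "layout ?C m = inp m" "layout ?C (Suc m) = inp m + length (ls m)"
        using layout_input[of m ?C] layout_input[of "Suc m" ?C] m D inp(1)[OF m] by auto
      show "I2 m (Suc l) (sem ?c ?C)"
      proof (cases "l < length (ls m)")
        case True
        have "layout ?C (inp m + l) = ls m ! l" using inp(2)[OF m True] layout_input by simp
        then have sem: "sem ?c ?C = update ?C ADJ (n * m + ls m ! l) 1"
          using vars addr True by simp
        have "ls m ! l \<in> nbh E m" using ls(1)[OF m] True nth_mem by blast
        then have lt: "ls m ! l < n" using nbh_in_V(1) by blast
        have "v \<in> set (take (Suc l) (ls m)) \<longleftrightarrow> v = ls m ! l \<or> v \<in> set (take l (ls m))" for v
          using True by (simp add: take_Suc_conv_app_nth)
        then show ?thesis
          unfolding sem using I2 lt by (auto simp: I2_def update_apply row_major_eq)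
      next
        case False
        then have "sem ?c ?C = ?C" using vars addr by simp
        then show ?thesis using I2 False by (simp add: I2_def update_apply)
      qed
    qed
    \<comment> \<open>No list is longer than \<open>n\<close>, so \<open>n\<close> rounds have read
      all of it.\<close>
    have "set (take n (ls m)) = nbh E m" using ls[OF m] by simp
    then show "I1 (Suc m) (sem (For VJ ?c) (update B VI 0 m))"
      unfolding C(2) using C(1) by (auto simp: I1_def I2_def update_apply less_Suc_eq)
  qed
  then show ?thesis using row by (auto simp: I1_def encodes_def update_apply)
qed

lemma full_correct:
  assumes c: "writes c = {ADJ, VI, VJ}"
    and enc: "\<And>A. (\<And>u. u < n \<Longrightarrow> A ROW u = n * u) \<Longrightarrow> A ADJ = (\<lambda>_. 0) \<Longrightarrow> encodes (sem c A)"
  shows "sem (full_prog c) (\<lambda>_ _. 0) FAIL 0 = 0 \<longleftrightarrow> domination_number {..<n} E = covering_number {..<n} E"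
proof -
  define A where "A = sem row_prog (\<lambda>_ _. 0)"
  have A: "A l = (\<lambda>_. 0)" if "l \<notin> {ROW, VI, VJ, ACC}" for l
    using that unfolding A_def by (subst sem_not_writes) auto
  have keep: "sem c A l = A l" if "l \<notin> {ADJ, VI, VJ}" for l
    using that c by (intro sem_not_writes) simp
  have "encodes (sem c A)"
    by (rule enc) (use row_correct A in \<open>auto simp: A_def\<close>)
  then have "sem decide_prog (sem c A) FAIL 0 = 0 \<longleftrightarrow> domination_number {..<n} E = covering_number {..<n} E"
    by (rule decide_correct) (simp_all add: keep A)
  then show ?thesis by (simp add: full_prog_def A_def)
qed

end

section \<open>Assembling the machine programs\<close>

definition halt_code :: "instr list" where
  "halt_code = compile_exp (Neg (Var FAIL)) 2 @ [Move 0 2]"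

text \<open>\<open>pre\<close> has to put the base address into register 1. Register 0 holds
  \<open>n\<close> until the last instruction, which replaces it by the answer and leaves the
  program counter just past the program.\<close>

definition assemble :: "instr list \<Rightarrow> com \<Rightarrow> program" where
  "assemble pre c = pre @ compile (length pre) c @ halt_code"

lemma (in ram) assemble_outputs:
  assumes wf: "wf_com c"
    and pre: "reach (assemble pre c) s t (Config (length pre) R (layout A))" "reserved R"
  shows "outputs_within (assemble pre c) s (t + cost n c + length halt_code) (of_bool (sem c A FAIL 0 = 0))"
proof -
  let ?P = "assemble pre c" and ?q = "length pre + code_size c"
  let ?e = "compile_exp (Neg (Var FAIL)) 2"
  have "code_at ?P (length pre) (compile (length pre) c @ halt_code)"
    unfolding code_at_def assemble_def by (rule exI[of _ pre], rule exI[of _ "[]"]) simp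
  then have code: "code_at ?P (length pre) (compile (length pre) c)" "code_at ?P ?q ?e"
    "code_at ?P (?q + length ?e) [Move 0 2]"
    by (auto simp: code_at_append halt_code_def)
  obtain R1 where R1: "reserved R1"
    "reach ?P (Config (length pre) R (layout A)) (cost n c) (Config ?q R1 (layout (sem c A)))"
    using compile_correct[OF code(1) wf, of A] pre(2) by (auto simp: runs_def)
  obtain R2 where R2: "reach ?P (Config ?q R1 (layout (sem c A))) (length ?e) (Config (?q + length ?e) R2 (layout (sem c A)))"
    "R2 2 = of_bool (sem c A FAIL 0 = 0)"
    using compile_exp_correct[OF code(2) R1(1), of "sem c A"] by auto
  from reach_trans[OF reach_trans[OF reach_trans[OF pre(1) R1(2)] R2(1)] reach_step[OF code(3) refl]]
  have "reach ?P s (t + cost n c + length halt_code)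
      (Config (length ?P) (R2(0 := of_bool (sem c A FAIL 0 = 0))) (layout (sem c A)))"
    using R2(2) by (simp add: halt_code_def assemble_def add.assoc)
  then show ?thesis
    by (auto simp: reach_def outputs_within_def halted_def)
qed

text \<open>A matrix input ends at address \<open>n * n\<close>, found by adding \<open>n\<close> to
  register 1, initially 0, \<open>n\<close> times. The jump targets are absolute, so this code must
  sit at position 0.\<close>

definition square_code :: "instr list" where
  "square_code = [Move 2 0, JumpZero 2 6, Add 1 1 0, Const 3 1, Sub 2 2 3, Jump 1]"

lemma code_at_square_code:
  assumes "code_at P 0 square_code"
  shows "code_at P 0 [Move 2 0]" "code_at P 1 [JumpZero 2 6]"
    "code_at P 2 [Add 1 1 0, Const 3 1, Sub 2 2 3]" "code_at P 5 [Jump 1]"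
proof -
  have "code_at P 0 ([Move 2 0] @ [JumpZero 2 6] @ [Add 1 1 0, Const 3 1, Sub 2 2 3] @ [Jump 1])"
    using assms by (simp add: square_code_def)
  then show "code_at P 0 [Move 2 0]" "code_at P 1 [JumpZero 2 6]"
    "code_at P 2 [Add 1 1 0, Const 3 1, Sub 2 2 3]" "code_at P 5 [Jump 1]"
    unfolding code_at_append by (simp_all add: eval_nat_numeral)
qed

text \<open>A round takes a test, three straight instructions and a jump; the extra step is the last
  test.\<close>

lemma square_loop:
  assumes code: "code_at P 0 square_code" and "R 2 = i"
  shows "\<exists>R'. reach P (Config 1 R M) (5 * i + 1) (Config 6 R' M) \<and> R' 0 = R 0 \<and> R' 1 = R 1 + i * R 0"
  using assms(2)
proof (induction i arbitrary: R)
  case 0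
  from reach_step[OF code_at_square_code(2)[OF code], of R M] show ?case using 0 by auto
next
  case (Suc i)
  note c = code_at_square_code(2-4)[OF code]
  define R1 where "R1 = R(1 := R 1 + R 0, 3 := 1, 2 := i)"
  have "reach P (Config 1 R M) 1 (Config 2 R M)"
    by (rule reach_step[OF c(1)]) (simp add: Suc.prems)
  moreover have "reach P (Config 2 R M) 3 (Config 5 R1 M)"
    using reach_straight[of P "Config 2 R M" "[Add 1 1 0, Const 3 1, Sub 2 2 3]"] c(2) Suc.prems
    by (simp add: R1_def eval_nat_numeral)
  moreover have "reach P (Config 5 R1 M) 1 (Config 1 R1 M)"
    by (rule reach_step[OF c(3)]) simp
  ultimately have "reach P (Config 1 R M) (1 + 3 + 1) (Config 1 R1 M)"
    using reach_trans by blast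
  moreover have "R1 2 = i" by (simp add: R1_def)
  from Suc.IH[of R1, OF this] obtain R' where R': "reach P (Config 1 R1 M) (5 * i + 1) (Config 6 R' M)"
    "R' 0 = R1 0" "R' 1 = R1 1 + i * R1 0"
    by blast
  ultimately have "reach P (Config 1 R M) (1 + 3 + 1 + (5 * i + 1)) (Config 6 R' M)"
    using reach_trans by blast
  then show ?case using R' by (intro exI[of _ R']) (simp add: R1_def)
qed

lemma square_correct:
  assumes "code_at P 0 square_code"
  shows "\<exists>R. reach P (Config 0 ((\<lambda>_. 0)(0 := n)) M) (5 * n + 2) (Config 6 R M) \<and> R 0 = n \<and> R 1 = n * n"
proof -
  let ?R = "((\<lambda>_. 0)(0 := n))(2 := n) :: reg \<Rightarrow> nat"
  from reach_step[OF code_at_square_code(1)[OF assms], of "(\<lambda>_. 0)(0 := n)" M]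
  have "reach P (Config 0 ((\<lambda>_. 0)(0 := n)) M) 1 (Config 1 ?R M)" by simp
  moreover obtain R where "reach P (Config 1 ?R M) (5 * n + 1) (Config 6 R M)" "R 0 = n" "R 1 = n * n"
    using square_loop[OF assms, of ?R n M] by auto
  ultimately show ?thesis using reach_trans by fastforce
qed

text \<open>The factor 4 comes from \<open>n + 1 \<le> 2 * n\<close> for \<open>n \<ge> 1\<close>;
  at \<open>n = 0\<close> the right-hand side vanishes, hence the restriction to large
  \<open>n\<close>.\<close>

lemma quadratic_bigo:
  assumes "\<And>n. T n \<le> K * (n + 1) ^ 2"
  shows "(\<lambda>n. real (T n)) \<in> O(\<lambda>n. real n ^ 2)"
proof (rule bigoI[of _ "4 * K"])
  show "\<forall>\<^sub>F n in sequentially. norm (real (T n)) \<le> real (4 * K) * norm (real n ^ 2)"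
  proof (rule eventually_sequentiallyI[of 1])
    fix n :: nat assume "1 \<le> n"
    then have "(n + 1) ^ 2 \<le> (2 * n) ^ 2" by (intro power_mono) auto
    then have "K * (n + 1) ^ 2 \<le> K * (2 * n) ^ 2" by (rule mult_le_mono2)
    also have "\<dots> = 4 * K * n ^ 2" by (simp add: power_mult_distrib)
    finally have "T n \<le> 4 * K * n ^ 2" using assms[of n] by (rule le_trans[rotated])
    then have "real (T n) \<le> real (4 * K * n ^ 2)" using of_nat_mono by blast
    then show "norm (real (T n)) \<le> real (4 * K) * norm (real n ^ 2)" by simp
  qed
qed

lemma cost_bigo:
  assumes "depth c \<le> 2"
  shows "(\<lambda>n. real (a * n + b + cost n c)) \<in> O(\<lambda>n. real n ^ 2)"
proof -
  obtain K where K: "\<And>n. cost n c \<le> K * (n + 1) ^ depth c" using cost_le_power by blast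
  have "a * n + b + cost n c \<le> (a + b + K) * (n + 1) ^ 2" for n
  proof -
    have "cost n c \<le> K * (n + 1) ^ 2"
      by (rule order.trans[OF K]) (intro mult_left_mono power_increasing assms; simp)
    moreover have "n \<le> (n + 1) ^ 2" "1 \<le> (n + 1) ^ 2" by (simp_all add: power2_eq_square)
    then have "a * n \<le> a * (n + 1) ^ 2" "b * 1 \<le> b * (n + 1) ^ 2" using mult_le_mono2 by blast+
    ultimately show ?thesis unfolding add_mult_distrib by linarith
  qed
  then show ?thesis by (rule quadratic_bigo)
qed

section \<open>Positions in the encoded graphs\<close>

lemma length_concat_square: "length (concat (map (\<lambda>u. map (f u) [0..<n]) [0..<m])) = m * n"
  by (induction m) auto

lemma concat_square_nth:
  "u < m \<Longrightarrow> v < n \<Longrightarrow> concat (map (\<lambda>u. map (f u) [0..<n]) [0..<m]) ! (n * u + v) = f u v"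
proof (induction m)
  case (Suc m)
  show ?case
  proof (cases "u < m")
    case True
    have "n * u + v < n * Suc u" using Suc.prems by simp
    also have "\<dots> \<le> n * m" using True by (intro mult_le_mono2) simp
    finally show ?thesis
      using True Suc by (simp add: nth_append length_concat_square mult.commute)
  next
    case False
    then have "u = m" using Suc.prems by simp
    then show ?thesis using Suc.prems by (simp add: nth_append length_concat_square mult.commute)
  qed
qed simp

lemma concat_nth_take:
  "u < length ls \<Longrightarrow> j < length (ls ! u) \<Longrightarrow> concat ls ! (length (concat (take u ls)) + j) = ls ! u ! j"
proof -
  assume u: "u < length ls" and j: "j < length (ls ! u)"
  have "concat ls = concat (take u ls) @ ls ! u @ concat (drop (Suc u) ls)"
    by (subst id_take_nth_drop[OF u]) simp
  then show ?thesis using j by (simp add: nth_append)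
qed

lemma length_concat_take_le: "length (concat (take u ls)) \<le> length (concat ls)"
proof -
  have "concat ls = concat (take u ls) @ concat (drop u ls)"
    by (metis append_take_drop_id concat_append)
  then show ?thesis by simp
qed

lemma length_encode_lists: "length (encode_lists ls) = Suc (length ls) + length (concat ls)"
  by (simp add: encode_lists_def)

lemma encode_lists_offset:
  "u \<le> length ls \<Longrightarrow> encode_lists ls ! u = Suc (length ls) + length (concat (take u ls))"
  unfolding encode_lists_def by (subst nth_append) (simp del: upt_Suc)

lemma encode_lists_entry:
  assumes "u < length ls" "j < length (ls ! u)"
  shows "encode_lists ls ! u + j < length (encode_lists ls) \<and> encode_lists ls ! (encode_lists ls ! u + j) = ls ! u ! j"
proof -
  have "length (concat (take u ls)) + length (ls ! u) = length (concat (take (Suc u) ls))"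
    using assms by (simp add: take_Suc_conv_app_nth)
  then have "length (concat (take u ls)) + j < length (concat ls)"
    using assms length_concat_take_le[of "Suc u" ls] by linarith
  moreover have "encode_lists ls ! (Suc (length ls) + (length (concat (take u ls)) + j)) = ls ! u ! j"
    unfolding encode_lists_def using concat_nth_take[OF assms]
    by (subst nth_append) (simp del: upt_Suc)
  ultimately show ?thesis
    using assms by (simp add: encode_lists_offset length_encode_lists add.assoc)
qed

text \<open>Memory past the input is zero, so with the base address at the end of the input the
  start configuration carries the zero store.\<close>

lemma start_layout:
  "start n xs = Config 0 ((\<lambda>_. 0)(0 := n)) (ram.layout (length xs) (\<lambda>a. xs ! a) (\<lambda>_ _. 0))"
  by (auto simp: start_def ram.layout_def)

section \<open>The two programs and their running times\<close>

definition lists_program :: program where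
  "lists_program = assemble [Load 1 0] (full_prog lists_prog)"

definition matrix_program :: program where
  "matrix_program = assemble square_code (full_prog matrix_prog)"

lemma full_prog_bounds:
  "wf_com c \<Longrightarrow> wf_com (full_prog c)" "depth c \<le> 2 \<Longrightarrow> depth (full_prog c) \<le> 2"
  by (simp_all add: full_prog_def wf_decide_prog depth_decide_prog)

text \<open>The summand \<open>0 * n\<close> puts the bound into the form required by
  \<open>cost_bigo\<close>; the base address costs only one step here.\<close>

lemma lists_program_correct:
  assumes "simple_graph {..<n} E" "\<forall>v. \<not> isolated_vertex {..<n} E v" "adjacency_lists n E ls"
  shows "outputs_within lists_program (start n (encode_lists ls)) (0 * n + (1 + length halt_code) + cost n (full_prog lists_prog))
    (if domination_number {..<n} E = covering_number {..<n} E then 1 else 0)"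
proof -
  define xs where "xs = encode_lists ls"
  interpret graph_program n "length xs" "\<lambda>a. xs ! a" E
    by unfold_locales (use assms in auto)
  have ls: "length ls = n" "\<And>u. u < n \<Longrightarrow> set (ls ! u) = nbh E u" "\<And>u. u < n \<Longrightarrow> distinct (ls ! u)"
    using assms(3) by (auto simp: adjacency_lists_def nbh_def)
  have "encodes (sem lists_prog A)" if "\<And>u. u < n \<Longrightarrow> A ROW u = n * u" "A ADJ = (\<lambda>_. 0)" for A
  proof (rule lists_correct[where ls = "\<lambda>u. ls ! u"])
    show "n < length xs" by (simp add: xs_def length_encode_lists ls)
    fix u assume u: "u < n"
    have "length (ls ! u) = card (nbh E u)" using ls(2,3)[OF u] distinct_card by metis
    also have "\<dots> \<le> card {..<n}" using nbh_in_V(1) by (intro card_mono) auto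
    finally show "length (ls ! u) \<le> n" by simp
    show "xs ! Suc u = xs ! u + length (ls ! u)"
      using u ls(1) by (simp add: xs_def encode_lists_offset take_Suc_conv_app_nth)
    show "j < length (ls ! u) \<Longrightarrow> xs ! u + j < length xs \<and> xs ! (xs ! u + j) = ls ! u ! j" for j
      unfolding xs_def by (rule encode_lists_entry) (use u ls in auto)
  qed (use that ls in auto)
  then have correct: "sem (full_prog lists_prog) (\<lambda>_ _. 0) FAIL 0 = 0 \<longleftrightarrow>
      domination_number {..<n} E = covering_number {..<n} E"
    by (intro full_correct) auto
  \<comment> \<open>Cell \<open>n\<close> of the offset table points just past the last list, that
    is, to the end of the input, so a single \<open>Load\<close> yields the base address.\<close>
  have "layout (\<lambda>_ _. 0) n = length xs"
    unfolding layout_def by (simp add: xs_def length_encode_lists encode_lists_offset ls)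
  moreover have "code_at lists_program 0 [Load 1 0]"
    by (simp add: code_at_singleton lists_program_def assemble_def)
  ultimately have "reach lists_program (start n xs) 1
      (Config 1 ((\<lambda>_. 0)(0 := n, 1 := length xs)) (layout (\<lambda>_ _. 0)))"
    unfolding start_layout by (intro reach_step) auto
  then have "outputs_within lists_program (start n xs) (1 + cost n (full_prog lists_prog) + length halt_code)
      (of_bool (sem (full_prog lists_prog) (\<lambda>_ _. 0) FAIL 0 = 0))"
    unfolding lists_program_def
    by (intro assemble_outputs) (auto simp: full_prog_bounds reserved_def)
  then show ?thesis unfolding correct unfolding xs_def by (simp add: of_bool_def add_ac)
qed

lemma matrix_program_correct:
  assumes "simple_graph {..<n} E" "\<forall>v. \<not> isolated_vertex {..<n} E v"
  shows "outputs_within matrix_program (start n (encode_matrix n E)) (5 * n + (2 + length halt_code) + cost n (full_prog matrix_prog))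
    (if domination_number {..<n} E = covering_number {..<n} E then 1 else 0)"
proof -
  define xs where "xs = encode_matrix n E"
  interpret graph_program n "length xs" "\<lambda>a. xs ! a" E
    by unfold_locales (use assms in auto)
  have len: "length xs = n * n"
    by (simp add: xs_def encode_matrix_def length_concat_square)
  have "encodes (sem matrix_prog A)" if "\<And>u. u < n \<Longrightarrow> A ROW u = n * u" for A
  proof (rule matrix_correct)
    fix u v assume "u < n" "v < n"
    then show "xs ! (n * u + v) = of_bool (v \<in> nbh E u)"
      unfolding xs_def encode_matrix_def by (subst concat_square_nth) (auto simp: nbh_def)
  qed (use that len in auto)
  then have correct: "sem (full_prog matrix_prog) (\<lambda>_ _. 0) FAIL 0 = 0 \<longleftrightarrow>
      domination_number {..<n} E = covering_number {..<n} E"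
    by (intro full_correct) auto
  have "code_at matrix_program 0 square_code"
    unfolding code_at_def matrix_program_def assemble_def by auto
  then obtain R where R: "reach matrix_program (start n xs) (5 * n + 2) (Config 6 R (layout (\<lambda>_ _. 0)))"
    "R 0 = n" "R 1 = n * n"
    unfolding start_layout using square_correct by blast
  then have "reserved R" unfolding reserved_def unfolding len by blast
  moreover have "length square_code = 6" by (simp add: square_code_def)
  ultimately have "outputs_within matrix_program (start n xs) (5 * n + 2 + cost n (full_prog matrix_prog) + length halt_code)
      (of_bool (sem (full_prog matrix_prog) (\<lambda>_ _. 0) FAIL 0 = 0))"
    using R(1) unfolding matrix_program_def
    by (intro assemble_outputs[where R = R]) (simp_all only: full_prog_bounds input_prog_simps)
  then show ?thesis unfolding correct unfolding xs_def by (simp add: of_bool_def add_ac)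
qed

theorem corollary15:
  "(\<exists>(P :: program) (T :: nat \<Rightarrow> nat).
      (\<lambda>n. real (T n)) \<in> O(\<lambda>n. real n ^ 2) \<and>
      (\<forall>(n :: nat) (E :: nat set set) (ls :: nat list list).
         simple_graph {..<n} E \<and> (\<forall>v. \<not> isolated_vertex {..<n} E v) \<and> adjacency_lists n E ls \<longrightarrow>
         outputs_within P (start n (encode_lists ls)) (T n)
           (if domination_number {..<n} E = covering_number {..<n} E then 1 else 0)))
   \<and>
   (\<exists>(P :: program) (T :: nat \<Rightarrow> nat).
      (\<lambda>n. real (T n)) \<in> O(\<lambda>n. real n ^ 2) \<and>
      (\<forall>(n :: nat) (E :: nat set set).
         simple_graph {..<n} E \<and> (\<forall>v. \<not> isolated_vertex {..<n} E v) \<longrightarrow>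
         outputs_within P (start n (encode_matrix n E)) (T n)
           (if domination_number {..<n} E = covering_number {..<n} E then 1 else 0)))"
proof (intro conjI exI allI impI)
  show "(\<lambda>n. real (0 * n + (1 + length halt_code) + cost n (full_prog lists_prog))) \<in> O(\<lambda>n. real n ^ 2)"
    by (rule cost_bigo) (simp add: full_prog_bounds)
  show "(\<lambda>n. real (5 * n + (2 + length halt_code) + cost n (full_prog matrix_prog))) \<in> O(\<lambda>n. real n ^ 2)"
    by (rule cost_bigo) (simp add: full_prog_bounds)
qed (blast intro: lists_program_correct matrix_program_correct)+

end
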